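(* Let $G$ be a (discrete) group. Then $\ell^\infty(G)$ admits a $G$-invariant conditional mean if and only if $G$ has the fixed-point property for cones.
   Context: $\ell^\infty(G)$ is the space of all bounded real functions on $G$ with the pointwise order and the $G$-action $(gf)(x)=f(g^{-1}x)$. A conditional mean on $\ell^\infty(G)$ is a function $P$ with values in $[0,1]$, defined on all pairs of bounded functions $0\leq f\leq h\neq 0$ (value written $P(f|h)$), such that: (CM1) $P(f_1+f_2|h)=P(f_1|h)+P(f_2|h)$ when $f_1,f_2\geq 0$ and $f_1+f_2\leq h\neq 0$; (CM2) $P(f_1|h)=P(f_1|f_2)P(f_2|h)$ when $0\leq f_1\leq f_2\leq h$ and $f_2\neq 0$; (CM3) $P(f|f)=1$ when $f\geq 0$, $f\neq 0$. It is $G$-invariant if $P(gf|h)=P(f|h)$ for all $g\in G$ where defined, i.e. whenever $0\leq f\leq h\neq 0$ and $gf\leq h$. A cone in a real vector space is a subset $C$ stable under addition and under multiplication by non-negative scalars; it is proper if $C\cap(-C)=\{0\}$. The group $G$ has the fixed-point property for cones if the following holds. Let $E$ be any Hausdorff locally convex real topological vector space ordered by a closed proper cone $C=E^+\subseteq E$ that is weakly complete (complete for the uniform structure induced by the weak topology of $E$), and let $G$ act on $E$ by continuous linear maps preserving $C$. Suppose that the action is (1) locally bounded: there is a non-zero $x\in C$ whose orbit $Gx$ is bounded in the sense of topological vector spaces; and (2) cobounded: there is $\varphi$ in the topological dual $E'$ such that for every $\lambda\in E'$ there are $g_1,\dots,g_n\in G$ with $\pm\lambda\leq\sum_{i=1}^n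 g_i\varphi$, where $E'$ carries the dual action $(g\varphi)(x)=\varphi(g^{-1}x)$ and $\alpha\leq\beta$ means $\alpha(x)\leq\beta(x)$ for all $x\in C$. Then $G$ has a non-zero fixed point in $C$. *)

theory Defs
  imports
    "HOL-Analysis.Analysis"
    "HOL-Algebra.Group_Action"
    "HOL-Library.Function_Algebras"
begin

section \<open>Bounded functions and conditional means\<close>

text \<open>
  Addition, \<open>0\<close> and \<open>\<le>\<close> on functions are pointwise. A real function on the group is represented
  by a function on the underlying type that vanishes off \<open>carrier G\<close>; this makes pointwise equality
  and order on \<open>carrier G\<close> agree with equality and order of functions.
\<close>

definition bounded_functions :: "('g, 'm) monoid_scheme \<Rightarrow> ('g \<Rightarrow> real) set" where
  "bounded_functions G = {f. bounded (f ` carrier G) \<and> (\<forall>x. x \<notin> carrier G \<longrightarrow> f x = 0)}"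

definition left_translate ::
    "('g, 'm) monoid_scheme \<Rightarrow> 'g \<Rightarrow> ('g \<Rightarrow> real) \<Rightarrow> 'g \<Rightarrow> real" where
  "left_translate G g f = (\<lambda>x. if x \<in> carrier G then f (inv\<^bsub>G\<^esub> g \<otimes>\<^bsub>G\<^esub> x) else 0)"

text \<open>
  The pairs on which a conditional mean is defined. A conditional mean is represented by a total
  function whose values outside these pairs are irrelevant.
\<close>

definition conditional_pair ::
    "('g, 'm) monoid_scheme \<Rightarrow> ('g \<Rightarrow> real) \<Rightarrow> ('g \<Rightarrow> real) \<Rightarrow> bool" where
  "conditional_pair G f h \<longleftrightarrow>
     f \<in> bounded_functions G \<and> h \<in> bounded_functions G \<and> 0 \<le> f \<and> f \<le> h \<and> h \<noteq> 0"

definition conditional_mean ::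
    "('g, 'm) monoid_scheme \<Rightarrow> (('g \<Rightarrow> real) \<Rightarrow> ('g \<Rightarrow> real) \<Rightarrow> real) \<Rightarrow> bool" where
  "conditional_mean G P \<longleftrightarrow>
     (\<forall>f h. conditional_pair G f h \<longrightarrow> 0 \<le> P f h \<and> P f h \<le> 1) \<and>
     (\<forall>f\<^sub>1 f\<^sub>2 h. f\<^sub>1 \<in> bounded_functions G \<and> f\<^sub>2 \<in> bounded_functions G \<and> h \<in> bounded_functions G \<and>
        0 \<le> f\<^sub>1 \<and> 0 \<le> f\<^sub>2 \<and> f\<^sub>1 + f\<^sub>2 \<le> h \<and> h \<noteq> 0 \<longrightarrow>
        P (f\<^sub>1 + f\<^sub>2) h = P f\<^sub>1 h + P f\<^sub>2 h) \<and>
     (\<forall>f\<^sub>1 f\<^sub>2 h. f\<^sub>1 \<in> bounded_functions G \<and> f\<^sub>2 \<in> bounded_functions G \<and> h \<in> bounded_functions G \<and>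
        0 \<le> f\<^sub>1 \<and> f\<^sub>1 \<le> f\<^sub>2 \<and> f\<^sub>2 \<le> h \<and> f\<^sub>2 \<noteq> 0 \<longrightarrow>
        P f\<^sub>1 h = P f\<^sub>1 f\<^sub>2 * P f\<^sub>2 h) \<and>
     (\<forall>f. f \<in> bounded_functions G \<and> 0 \<le> f \<and> f \<noteq> 0 \<longrightarrow> P f f = 1)"

definition invariant_conditional_mean ::
    "('g, 'm) monoid_scheme \<Rightarrow> (('g \<Rightarrow> real) \<Rightarrow> ('g \<Rightarrow> real) \<Rightarrow> real) \<Rightarrow> bool" where
  "invariant_conditional_mean G P \<longleftrightarrow>
     conditional_mean G P \<and>
     (\<forall>g f h. g \<in> carrier G \<and> conditional_pair G f h \<and> left_translate G g f \<le> h \<longrightarrow>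
        P (left_translate G g f) h = P f h)"


section \<open>Ordered locally convex spaces\<close>

text \<open>
  A topological vector space is a linear subspace \<open>topspace T\<close> of a type of class
  \<open>real_vector\<close>, with a topology \<open>T\<close> that need not come from the type.
\<close>

definition linear_map_on :: "'e::real_vector set \<Rightarrow> ('e \<Rightarrow> 'f::real_vector) \<Rightarrow> bool" where
  "linear_map_on E f \<longleftrightarrow>
     (\<forall>x\<in>E. \<forall>y\<in>E. f (x + y) = f x + f y) \<and> (\<forall>c. \<forall>x\<in>E. f (c *\<^sub>R x) = c *\<^sub>R f x)"

definition hausdorff_locally_convex_space :: "'e::real_vector topology \<Rightarrow> bool" where
  "hausdorff_locally_convex_space T \<longleftrightarrow>
     subspace (topspace T) \<and>
     continuous_map (prod_topology T T) T (\<lambda>(x, y). x + y) \<and>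
     continuous_map (prod_topology euclideanreal T) T (\<lambda>(c, x). c *\<^sub>R x) \<and>
     Hausdorff_space T \<and>
     neighbourhood_base_of convex T"

text \<open>
  Functionals are total functions; only their values on \<open>topspace T\<close> are ever used.
\<close>

definition topological_dual :: "'e::real_vector topology \<Rightarrow> ('e \<Rightarrow> real) set" where
  "topological_dual T = {\<phi>. linear_map_on (topspace T) \<phi> \<and> continuous_map T euclideanreal \<phi>}"

definition tvs_bounded :: "'e::real_vector topology \<Rightarrow> 'e set \<Rightarrow> bool" where
  "tvs_bounded T S \<longleftrightarrow>
     S \<subseteq> topspace T \<and>
     (\<forall>U. openin T U \<and> 0 \<in> U \<longrightarrow> (\<exists>s>0. \<forall>t>s. S \<subseteq> (\<lambda>x. t *\<^sub>R x) ` U))"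

text \<open>
  The uniform structure of the weak topology: the initial uniformity on \<open>topspace T\<close> for the
  functionals in the dual, as a filter of entourages.
\<close>

definition weak_uniformity :: "'e::real_vector topology \<Rightarrow> ('e \<times> 'e) filter" where
  "weak_uniformity T =
     inf (principal (topspace T \<times> topspace T))
         (INF \<phi>\<in>topological_dual T. filtercomap (map_prod \<phi> \<phi>) uniformity)"

text \<open>
  The counterpart, for a uniformity \<open>\<U>\<close> on a carrier, of \<open>complete\<close> in the class
  \<open>uniform_space\<close>: every proper Cauchy filter on \<open>S\<close> converges to a point of \<open>S\<close>.
\<close>

definition complete_wrt :: "('e \<times> 'e) filter \<Rightarrow> 'e set \<Rightarrow> bool" where
  "complete_wrt \<U> S \<longleftrightarrow>
     (\<forall>F. F \<le> principal S \<and> F \<noteq> bot \<and> F \<times>\<^sub>F F \<le> \<U> \<longrightarrow>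
        (\<exists>x\<in>S. filterlim (\<lambda>y. (x, y)) \<U> F))"

definition proper_cone :: "'e::real_vector set \<Rightarrow> bool" where
  "proper_cone C \<longleftrightarrow>
     cone C \<and> (\<forall>x\<in>C. \<forall>y\<in>C. x + y \<in> C) \<and> C \<inter> uminus ` C = {0}"


section \<open>The fixed-point property for cones\<close>

definition continuous_linear_action ::
    "('g, 'm) monoid_scheme \<Rightarrow> 'e::real_vector topology \<Rightarrow> ('g \<Rightarrow> 'e \<Rightarrow> 'e) \<Rightarrow> bool" where
  "continuous_linear_action G T \<pi> \<longleftrightarrow>
     group_action G (topspace T) \<pi> \<and>
     (\<forall>g\<in>carrier G. linear_map_on (topspace T) (\<pi> g) \<and> continuous_map T T (\<pi> g))"

definition locally_bounded_action ::
    "('g, 'm) monoid_scheme \<Rightarrow> 'e::real_vector topology \<Rightarrow> 'e set \<Rightarrow> ('g \<Rightarrow> 'e \<Rightarrow> 'e) \<Rightarrow> bool" where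
  "locally_bounded_action G T C \<pi> \<longleftrightarrow> (\<exists>x\<in>C. x \<noteq> 0 \<and> tvs_bounded T (orbit G \<pi> x))"

definition dual_action ::
    "('g, 'm) monoid_scheme \<Rightarrow> ('g \<Rightarrow> 'e \<Rightarrow> 'e) \<Rightarrow> 'g \<Rightarrow> ('e \<Rightarrow> real) \<Rightarrow> 'e \<Rightarrow> real" where
  "dual_action G \<pi> g \<phi> = (\<lambda>x. \<phi> (\<pi> (inv\<^bsub>G\<^esub> g) x))"

definition dual_le :: "'e set \<Rightarrow> ('e \<Rightarrow> real) \<Rightarrow> ('e \<Rightarrow> real) \<Rightarrow> bool" where
  "dual_le C \<alpha> \<beta> \<longleftrightarrow> (\<forall>x\<in>C. \<alpha> x \<le> \<beta> x)"

definition cobounded_action ::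
    "('g, 'm) monoid_scheme \<Rightarrow> 'e::real_vector topology \<Rightarrow> 'e set \<Rightarrow> ('g \<Rightarrow> 'e \<Rightarrow> 'e) \<Rightarrow> bool" where
  "cobounded_action G T C \<pi> \<longleftrightarrow>
     (\<exists>\<phi>\<in>topological_dual T. \<forall>\<psi>\<in>topological_dual T. \<exists>gs. set gs \<subseteq> carrier G \<and>
        dual_le C \<psi> (\<Sum>g\<leftarrow>gs. dual_action G \<pi> g \<phi>) \<and>
        dual_le C (- \<psi>) (\<Sum>g\<leftarrow>gs. dual_action G \<pi> g \<phi>))"

text \<open>
  The type argument bounds the universe over which the spaces range: all locally convex spaces
  carried by a linear subspace of \<open>'e\<close>.
\<close>

definition fixed_point_property_for_cones ::
    "('g, 'm) monoid_scheme \<Rightarrow> 'e::real_vector itself \<Rightarrow> bool" where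
  "fixed_point_property_for_cones G (_ :: 'e itself) \<longleftrightarrow>
     (\<forall>(T :: 'e topology) C \<pi>.
        hausdorff_locally_convex_space T \<and>
        proper_cone C \<and> closedin T C \<and> complete_wrt (weak_uniformity T) C \<and>
        continuous_linear_action G T \<pi> \<and> (\<forall>g\<in>carrier G. \<pi> g ` C \<subseteq> C) \<and>
        locally_bounded_action G T C \<pi> \<and> cobounded_action G T C \<pi> \<longrightarrow>
        (\<exists>x\<in>C. x \<noteq> 0 \<and> (\<forall>g\<in>carrier G. \<pi> g x = x)))"


section \<open>A universe\<close>

text \<open>
  Functions into a real vector space form a real vector space, so that
  \<open>('g \<Rightarrow> real) \<Rightarrow> real\<close>, which contains the duals of all spaces of real functions on a group
  with elements in \<open>'g\<close>, can serve as a universe.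
\<close>

instantiation "fun" :: (type, real_vector) real_vector
begin

definition scaleR_fun :: "real \<Rightarrow> ('a \<Rightarrow> 'b) \<Rightarrow> 'a \<Rightarrow> 'b" where
  "scaleR_fun c f = (\<lambda>x. c *\<^sub>R f x)"

instance
  by standard (simp_all add: scaleR_fun_def fun_eq_iff scaleR_add_right scaleR_add_left)

end

end

theory Submission
  imports Defs
begin

text \<open>
  Both properties are equivalent to the existence, for every non-zero \<open>f \<ge> 0\<close>, of a positive invariant
  functional that is finite on the functions dominated by finite sums of translates of \<open>f\<close> and
  positive at \<open>f\<close>. Such a functional is a fixed point in the cone of positive functionals on these
  functions. Conversely, for \<open>f\<close> the function \<open>g \<mapsto> \<phi> (g x)\<close>, where \<open>\<phi>\<close> is cobounding and \<open>x\<close> has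
  bounded orbit, it induces a functional on the dual, which weak completeness represents by a fixed
  point. A conditional mean gives such functionals as quotients \<open>P h H / P f H\<close>; in the other
  direction finitely many second arguments are handled by successive functionals, each used where
  the previous ones vanish, and compactness gives a mean for all of them at once.
\<close>

section \<open>The Hahn--Banach theorem\<close>

text \<open>Integrals attached to one function at a time are the natural meeting point:
  coboundedness compares every continuous functional with translates of a single one, and (CM2)
  makes the ratio of two conditional means independent of their common second argument. Fixing
  \<open>f\<close> is essential, since an integral positive at a small \<open>f\<close> may be
  infinite on larger functions.

  The obstacle is the way back to a mean. A functional that is finite and positive at a large
  function may vanish at a smaller one, where it defines no quotient, so in general no single
  functional serves all second arguments. Null functions form a lower scale on which another
  functional is used; (CM2) across two scales holds because both of its sides are then
  \<open>0\<close>. Each axiom involves at most two second arguments, so solving all finite families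
  is enough for a compactness argument.

  The passage from means to fixed points works in any real vector space. The converse uses one space
  per \<open>f\<close>, the algebraic dual of the functions dominated by \<open>f\<close>, and this
  lives inside \<open>('g \<Rightarrow> real) \<Rightarrow> real\<close>.\<close>

lemma linear_map_onD:
  assumes "linear_map_on E f"
  shows linear_map_on_add: "x \<in> E \<Longrightarrow> y \<in> E \<Longrightarrow> f (x + y) = f x + f y"
    and linear_map_on_scale: "x \<in> E \<Longrightarrow> f (c *\<^sub>R x) = c *\<^sub>R f x"
  using assms unfolding linear_map_on_def by auto

lemma linear_map_on_zero:
  assumes "linear_map_on E f" "subspace E"
  shows "f 0 = 0"
  using linear_map_on_scale[OF assms(1), of 0 0] subspace_0[OF assms(2)] by simp

lemma linear_map_on_minus:
  assumes "linear_map_on E f" "x \<in> E"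
  shows "f (- x) = - f x"
  using linear_map_on_scale[OF assms, of "-1"] by simp

definition sublinear_on :: "'e::real_vector set \<Rightarrow> ('e \<Rightarrow> real) \<Rightarrow> bool" where
  "sublinear_on E p \<longleftrightarrow>
     (\<forall>x\<in>E. \<forall>y\<in>E. p (x + y) \<le> p x + p y) \<and> (\<forall>c\<ge>0. \<forall>x\<in>E. p (c *\<^sub>R x) = c * p x)"

lemma sublinear_onD:
  assumes "sublinear_on E p"
  shows sublinear_on_add: "x \<in> E \<Longrightarrow> y \<in> E \<Longrightarrow> p (x + y) \<le> p x + p y"
    and sublinear_on_scale: "c \<ge> 0 \<Longrightarrow> x \<in> E \<Longrightarrow> p (c *\<^sub>R x) = c * p x"
  using assms unfolding sublinear_on_def by auto

text \<open>Supplies the common lower bound \<open>- p (- x)\<close> for all sublinear functionals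
  below \<open>p\<close>, so that infima along chains are finite.\<close>

lemma sublinear_on_neg:
  assumes "subspace E" "sublinear_on E p" "x \<in> E"
  shows "- p (- x) \<le> p x"
proof -
  have "0 = p 0"
    using sublinear_on_scale[OF assms(2), of 0 0] subspace_0[OF assms(1)] by simp
  also have "\<dots> \<le> p x + p (- x)"
    using sublinear_on_add[OF assms(2,3), of "- x"] subspace_neg[OF assms(1,3)] by simp
  finally show ?thesis by simp
qed

text \<open>The inequality for positive factors already yields equality: apply it to the factor
  \<open>1/c\<close> and the vector \<open>c *\<^sub>R x\<close>.\<close>

lemma sublinear_onI:
  assumes E: "subspace E"
    and add: "\<And>x y. x \<in> E \<Longrightarrow> y \<in> E \<Longrightarrow> p (x + y) \<le> p x + p y"
    and zero: "p 0 = 0"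
    and scale: "\<And>c x. c > 0 \<Longrightarrow> x \<in> E \<Longrightarrow> p (c *\<^sub>R x) \<le> c * p x"
  shows "sublinear_on E p"
  unfolding sublinear_on_def
proof (intro conjI ballI allI impI)
  fix c :: real and x assume "c \<ge> 0" and x: "x \<in> E"
  show "p (c *\<^sub>R x) = c * p x"
  proof (cases "c = 0")
    case False
    with \<open>c \<ge> 0\<close> have c: "c > 0" by simp
    have "p ((1/c) *\<^sub>R (c *\<^sub>R x)) \<le> (1/c) * p (c *\<^sub>R x)"
      by (rule scale) (use c x E in \<open>auto intro: subspace_scale\<close>)
    hence "c * p x \<le> p (c *\<^sub>R x)"
      using c by (simp add: field_simps)
    with scale[OF c x] show ?thesis by simp
  qed (use zero in simp)
qed (use add in auto)

text \<open>A minimal sublinear functional equals all its shifts, and is therefore additive.\<close>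

lemma sublinear_on_shift:
  fixes p :: "'e::real_vector \<Rightarrow> real"
  assumes E: "subspace E" and p: "sublinear_on E p" and y: "y \<in> E"
  defines "q \<equiv> \<lambda>x. INF t\<in>{0..}. p (x + t *\<^sub>R y) - t * p y"
  shows "sublinear_on E q" "\<And>x. x \<in> E \<Longrightarrow> q x \<le> p x" "\<And>x. x \<in> E \<Longrightarrow> q x \<le> p (x + y) - p y"
proof -
  have in_E: "x + t *\<^sub>R y \<in> E" if "x \<in> E" for x t
    using E y that by (simp add: subspace_add subspace_scale)
  have bdd: "bdd_below ((\<lambda>t. p (x + t *\<^sub>R y) - t * p y) ` {0..})" if x: "x \<in> E" for x
  proof (rule bdd_belowI2)
    fix t :: real assume t: "t \<in> {0..}"
    have "t * p y = p ((x + t *\<^sub>R y) + (- x))"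
      using sublinear_on_scale[OF p _ y, of t] t by simp
    also have "\<dots> \<le> p (x + t *\<^sub>R y) + p (- x)"
      using sublinear_on_add[OF p in_E[OF x] subspace_neg[OF E x], of t] by simp
    finally show "- p (- x) \<le> p (x + t *\<^sub>R y) - t * p y" by simp
  qed
  have le: "q x \<le> p (x + t *\<^sub>R y) - t * p y" if "x \<in> E" "t \<ge> 0" for x t
    unfolding q_def by (rule cINF_lower[OF bdd]) (use that in auto)
  have q_eq: "q x = (INF t\<in>{0..}. p (x + t *\<^sub>R y) - t * p y)" for x
    by (simp add: q_def)
  show "q x \<le> p x" if "x \<in> E" for x
    using le[OF that, of 0] by simp
  show "q x \<le> p (x + y) - p y" if "x \<in> E" for x
    using le[OF that, of 1] by simp
  show "sublinear_on E q"
  proof (rule sublinear_onI[OF E])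
    fix x z assume x: "x \<in> E" and z: "z \<in> E"
    have *: "q (x + z) \<le> (p (x + s *\<^sub>R y) - s * p y) + (p (z + t *\<^sub>R y) - t * p y)"
      if s: "s \<ge> 0" and t: "t \<ge> 0" for s t
    proof -
      have "q (x + z) \<le> p (x + z + (s + t) *\<^sub>R y) - (s + t) * p y"
        using le[of "x + z" "s + t"] s t x z E by (simp add: subspace_add)
      also have "x + z + (s + t) *\<^sub>R y = (x + s *\<^sub>R y) + (z + t *\<^sub>R y)"
        by (simp add: algebra_simps)
      also have "p \<dots> \<le> p (x + s *\<^sub>R y) + p (z + t *\<^sub>R y)"
        by (intro sublinear_on_add[OF p] in_E x z)
      finally show ?thesis by (simp add: algebra_simps)
    qed
    have "q (x + z) - (p (x + s *\<^sub>R y) - s * p y) \<le> q z" if "s \<ge> 0" for s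
      unfolding q_eq[of z]
      by (rule cINF_greatest) (use *[OF that] in \<open>auto simp: algebra_simps\<close>)
    hence "q (x + z) - q z \<le> q x"
      unfolding q_eq[of x]
      by (intro cINF_greatest) (auto simp: algebra_simps)
    thus "q (x + z) \<le> q x + q z" by simp
  next
    have "p (0 + t *\<^sub>R y) - t * p y = 0" if "t \<ge> 0" for t
      using sublinear_on_scale[OF p that y] by simp
    hence "(\<lambda>t. p (0 + t *\<^sub>R y) - t * p y) ` {0..} = (\<lambda>t. 0) ` {0::real..}"
      by (intro image_cong) auto
    thus "q 0 = 0" unfolding q_def by simp
  next
    fix c :: real and x assume c: "c > 0" and x: "x \<in> E"
    have "q (c *\<^sub>R x) / c \<le> p (x + t *\<^sub>R y) - t * p y" if t: "t \<ge> 0" for t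
    proof -
      have "q (c *\<^sub>R x) \<le> p (c *\<^sub>R x + (c * t) *\<^sub>R y) - (c * t) * p y"
        using c t x E by (intro le) (auto simp: subspace_scale)
      also have "c *\<^sub>R x + (c * t) *\<^sub>R y = c *\<^sub>R (x + t *\<^sub>R y)"
        by (simp add: scaleR_right_distrib)
      also have "p \<dots> = c * p (x + t *\<^sub>R y)"
        using c by (intro sublinear_on_scale[OF p] in_E x) auto
      finally show ?thesis using c by (simp add: field_simps)
    qed
    hence "q (c *\<^sub>R x) / c \<le> q x"
      unfolding q_eq[of x] by (intro cINF_greatest) auto
    thus "q (c *\<^sub>R x) \<le> c * q x" using c by (simp add: field_simps)
  qed
qed

text \<open>Zorn's lemma for the reversed pointwise order; the lower bound of a chain is its
  pointwise infimum.\<close>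

lemma minimal_sublinear_on:
  fixes p :: "'e::real_vector \<Rightarrow> real"
  assumes E: "subspace E" and p: "sublinear_on E p"
  obtains q where "sublinear_on E q" "\<And>x. x \<in> E \<Longrightarrow> q x \<le> p x"
    "\<And>r x. sublinear_on E r \<Longrightarrow> (\<And>x. x \<in> E \<Longrightarrow> r x \<le> q x) \<Longrightarrow> x \<in> E \<Longrightarrow> r x = q x"
proof -
  define A where "A = {q. sublinear_on E q \<and> (\<forall>x\<in>E. q x \<le> p x) \<and> (\<forall>x. x \<notin> E \<longrightarrow> q x = 0)}"
  \<comment> \<open>The order compares functions on the whole type. Setting them to \<open>0\<close>
    off \<open>E\<close> makes it agree with comparison on \<open>E\<close>, so that minimality
    gives an equality of functions.\<close>
  define cut where "cut q = (\<lambda>x. if x \<in> E then q x else 0 :: real)" for q :: "'e \<Rightarrow> real"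
  have cut_sub: "sublinear_on E (cut q)" if "sublinear_on E q" for q
    using that E unfolding sublinear_on_def cut_def by (auto simp: subspace_add subspace_scale)
  have cut_A: "cut q \<in> A" if "sublinear_on E q" "\<And>x. x \<in> E \<Longrightarrow> q x \<le> p x" for q
    using cut_sub[OF that(1)] that(2) unfolding A_def by (auto simp: cut_def)
  let ?P = "\<lambda>a b :: 'e \<Rightarrow> real. b \<le> a"
  have "\<exists>m\<in>A. \<forall>a\<in>A. ?P m a \<longrightarrow> a = m"
  proof (rule predicate_Zorn)
    show "partial_order_on A (relation_of ?P A)"
      by (rule partial_order_on_relation_ofI) auto
  next
    fix C assume C: "C \<in> Chains (relation_of ?P A)"
    have CA: "C \<subseteq> A" and chain: "\<And>a b. a \<in> C \<Longrightarrow> b \<in> C \<Longrightarrow> a \<le> b \<or> b \<le> a"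
      using C unfolding Chains_def relation_of_def by auto
    show "\<exists>u\<in>A. \<forall>a\<in>C. ?P a u"
    proof (cases "C = {}")
      case True
      thus ?thesis using cut_A[OF p] by auto
    next
      case False
      define u where "u x = (INF q\<in>C. q x)" for x
      have bdd: "bdd_below ((\<lambda>q. q x) ` C)" if x: "x \<in> E" for x
      proof (rule bdd_belowI2)
        fix q assume "q \<in> C"
        hence "sublinear_on E q" "q (- x) \<le> p (- x)"
          using CA subspace_neg[OF E x] unfolding A_def by auto
        thus "- p (- x) \<le> q x" using sublinear_on_neg[OF E _ x, of q] by simp
      qed
      have le: "u x \<le> q x" if "x \<in> E" "q \<in> C" for x q
        unfolding u_def by (rule cINF_lower[OF bdd]) (use that in auto)
      have sub: "sublinear_on E q" if "q \<in> C" for q using that CA unfolding A_def by auto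
      have "sublinear_on E u"
      proof (rule sublinear_onI[OF E])
        fix x y assume x: "x \<in> E" and y: "y \<in> E"
        have *: "u (x + y) \<le> q x + r y" if qr: "q \<in> C" "r \<in> C" for q r
        proof -
          \<comment> \<open>The infima at \<open>x\<close> and at \<open>y\<close> may be approached
            by different members; in a chain the smaller of the two serves both.\<close>
          define m where "m = (if q \<le> r then q else r)"
          have m: "m \<in> C" "m \<le> q" "m \<le> r"
            using chain[OF qr] qr by (auto simp: m_def)
          have "u (x + y) \<le> m (x + y)"
            by (rule le) (use m x y E in \<open>auto simp: subspace_add\<close>)
          also have "\<dots> \<le> m x + m y" by (rule sublinear_on_add[OF sub[OF m(1)] x y])
          also have "\<dots> \<le> q x + r y" using m by (auto intro: add_mono simp: le_fun_def)
          finally show ?thesis .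
        qed
        have "u (x + y) - q x \<le> u y" if "q \<in> C" for q
          unfolding u_def[of y]
          by (rule cINF_greatest) (use *[OF that] False in \<open>auto simp: algebra_simps\<close>)
        hence "u (x + y) - u y \<le> u x"
          unfolding u_def[of x] using False by (intro cINF_greatest) (auto simp: algebra_simps)
        thus "u (x + y) \<le> u x + u y" by simp
      next
        have "q 0 = 0" if "q \<in> C" for q
          using sublinear_on_scale[OF sub[OF that], of 0 0] subspace_0[OF E] by simp
        hence "(\<lambda>q. q 0) ` C = (\<lambda>q. 0) ` C" by (intro image_cong) auto
        thus "u 0 = 0" unfolding u_def using False by simp
      next
        fix c :: real and x assume c: "c > 0" and x: "x \<in> E"
        have "u (c *\<^sub>R x) / c \<le> q x" if q: "q \<in> C" for q
          using le[OF subspace_scale[OF E x] q, of c] sublinear_on_scale[OF sub[OF q] _ x, of c] c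
          by (simp add: field_simps)
        hence "u (c *\<^sub>R x) / c \<le> u x"
          unfolding u_def[of x] using False by (intro cINF_greatest) auto
        thus "u (c *\<^sub>R x) \<le> c * u x" using c by (simp add: field_simps)
      qed
      moreover have "u x \<le> p x" if "x \<in> E" for x
      proof -
        obtain q where q: "q \<in> C" using False by auto
        have "q x \<le> p x" using q CA that unfolding A_def by auto
        with le[OF that q] show ?thesis by simp
      qed
      ultimately have "cut u \<in> A" by (rule cut_A)
      moreover have "cut u \<le> q" if "q \<in> C" for q
      proof (rule le_funI)
        fix x show "cut u x \<le> q x"
          using le[of x q] that CA unfolding A_def cut_def by auto
      qed
      ultimately show ?thesis by blast
    qed
  qed
  then obtain q where q: "q \<in> A" and min: "\<And>a. a \<in> A \<Longrightarrow> a \<le> q \<Longrightarrow> a = q" by blast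
  show thesis
  proof (rule that)
    show "sublinear_on E q" "\<And>x. x \<in> E \<Longrightarrow> q x \<le> p x" using q unfolding A_def by auto
    fix r x assume r: "sublinear_on E r" "\<And>x. x \<in> E \<Longrightarrow> r x \<le> q x" and x: "x \<in> E"
    have "cut r \<in> A"
      by (rule cut_A[OF r(1)]) (use r(2) q in \<open>force simp: A_def\<close>)
    moreover have "cut r \<le> q"
      using r(2) q by (auto simp: le_fun_def cut_def A_def)
    ultimately have "cut r = q" by (rule min)
    thus "r x = q x" using x by (auto simp: cut_def)
  qed
qed

text \<open>Minimality is used below \<open>p'\<close>, the shift of \<open>p\<close> along
  \<open>y\<close>, rather than below \<open>p\<close> itself: then
  \<open>L (- y) \<le> p' (- y) \<le> - p y\<close>, which forces \<open>L y\<close> up to its bound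
  \<open>p y\<close>.\<close>

theorem hahn_banach:
  fixes p :: "'e::real_vector \<Rightarrow> real"
  assumes E: "subspace E" and p: "sublinear_on E p" and y: "y \<in> E"
  obtains L where "linear_map_on E L" "\<And>x. x \<in> E \<Longrightarrow> L x \<le> p x" "L y = p y"
proof -
  define p' where "p' x = (INF t\<in>{0..}. p (x + t *\<^sub>R y) - t * p y)" for x
  note p' = sublinear_on_shift[OF E p y, folded p'_def]
  obtain L where L: "sublinear_on E L" "\<And>x. x \<in> E \<Longrightarrow> L x \<le> p' x"
    and min: "\<And>r x. sublinear_on E r \<Longrightarrow> (\<And>x. x \<in> E \<Longrightarrow> r x \<le> L x) \<Longrightarrow> x \<in> E \<Longrightarrow> r x = L x"
    using minimal_sublinear_on[OF E p'(1)] by metis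
  have add: "L (x + z) = L x + L z" if x: "x \<in> E" and z: "z \<in> E" for x z
  proof -
    define r where "r x = (INF t\<in>{0..}. L (x + t *\<^sub>R z) - t * L z)" for x
    note r = sublinear_on_shift[OF E L(1) z, folded r_def]
    have "L x = r x" using min[OF r(1,2) x] by simp
    also have "\<dots> \<le> L (x + z) - L z" by (rule r(3)[OF x])
    finally show ?thesis using sublinear_on_add[OF L(1) x z] by simp
  qed
  have neg: "L (- x) = - L x" if x: "x \<in> E" for x
    using add[OF x subspace_neg[OF E x]] sublinear_on_scale[OF L(1), of 0 0] subspace_0[OF E] by simp
  have scale: "L (c *\<^sub>R x) = c * L x" if x: "x \<in> E" for c x
  proof (cases "c \<ge> 0")
    case False
    hence "L ((- c) *\<^sub>R x) = - c * L x" by (intro sublinear_on_scale[OF L(1) _ x]) auto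
    moreover have "L ((- c) *\<^sub>R x) = - L (c *\<^sub>R x)"
      using neg[OF subspace_scale[OF E x, of c]] by simp
    ultimately show ?thesis by simp
  qed (rule sublinear_on_scale[OF L(1) _ x])
  have le: "L x \<le> p x" if "x \<in> E" for x
    using L(2)[OF that] p'(2)[OF that] by simp
  have "L (- y) \<le> p (- y + y) - p y"
    using L(2) p'(3) subspace_neg[OF E y] order_trans by blast
  hence "p y \<le> L y"
    using neg[OF y] sublinear_on_scale[OF p, of 0 0] subspace_0[OF E] by simp
  with le[OF y] have "L y = p y" by simp
  with le add scale show thesis by (intro that[of L]) (auto simp: linear_map_on_def)
qed

section \<open>Locally convex spaces\<close>

lemma topological_dualD:
  assumes "\<psi> \<in> topological_dual T"
  shows topological_dual_linear: "linear_map_on (topspace T) \<psi>"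
    and topological_dual_continuous: "continuous_map T euclideanreal \<psi>"
  using assms unfolding topological_dual_def by auto

lemma continuous_map_affine:
  assumes T: "hausdorff_locally_convex_space T" and y: "y \<in> topspace T"
  shows "continuous_map T T (\<lambda>z. c *\<^sub>R (z + y))"
proof -
  have "continuous_map T T (\<lambda>z. z + y)"
    using continuous_map_compose[of T "prod_topology T T" "\<lambda>z. (z, y)" T "\<lambda>(x, y). x + y"] T y
    unfolding hausdorff_locally_convex_space_def by (simp add: o_def continuous_map_pairwise)
  hence "continuous_map T (prod_topology euclideanreal T) (\<lambda>z. (c, z + y))"
    by (simp add: o_def continuous_map_pairwise)
  from continuous_map_compose[OF this, of T "\<lambda>(c, x). c *\<^sub>R x"] show ?thesis
    using T unfolding hausdorff_locally_convex_space_def by (simp add: o_def)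
qed

text \<open>Translation and scaling carry the bound at \<open>0\<close> to any point
  \<open>y\<close>. An upper bound controls absolute values because it is applied both to a positive
  and to a negative multiple of \<open>z - y\<close>.\<close>

lemma topological_dualI_bounded_above:
  assumes T: "hausdorff_locally_convex_space T"
    and L: "linear_map_on (topspace T) L"
    and U: "openin T U" "0 \<in> U" "\<And>x. x \<in> U \<Longrightarrow> L x \<le> 1"
  shows "L \<in> topological_dual T"
proof -
  let ?E = "topspace T"
  have E: "subspace ?E" using T unfolding hausdorff_locally_convex_space_def by simp
  have "openin T {x \<in> ?E. L x \<in> S}" if S: "open S" for S
  proof (subst openin_subopen, intro ballI)
    fix y assume "y \<in> {x \<in> ?E. L x \<in> S}"
    hence y: "y \<in> ?E" "L y \<in> S" by auto
    obtain e where e: "e > 0" "ball (L y) e \<subseteq> S"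
      using S y(2) openE by blast
    have my: "- y \<in> ?E" using y(1) E by (rule subspace_neg[rotated])
    \<comment> \<open>The factor \<open>2/e\<close> yields
      \<open>\<bar>L z - L y\<bar> \<le> e / 2\<close>, leaving room for the strict inequality of
      the ball.\<close>
    define N where "N = {z \<in> ?E. (2/e) *\<^sub>R (z + - y) \<in> U} \<inter> {z \<in> ?E. (-2/e) *\<^sub>R (z + - y) \<in> U}"
    have "openin T N"
      unfolding N_def
      by (intro openin_Int openin_continuous_map_preimage[OF continuous_map_affine[OF T my] U(1)])
    moreover have "y \<in> N"
      using y(1) U(2) by (simp add: N_def)
    moreover have "N \<subseteq> {x \<in> ?E. L x \<in> S}"
    proof
      fix z assume z: "z \<in> N"
      hence zE: "z \<in> ?E" by (auto simp: N_def)
      have zy: "z + - y \<in> ?E" using zE my E by (intro subspace_add)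
      have L_eq: "L (c *\<^sub>R (z + - y)) = c * (L z - L y)" for c
        using linear_map_on_scale[OF L zy, of c] linear_map_on_add[OF L zE my]
          linear_map_on_minus[OF L y(1)] by simp
      have "(2/e) * (L z - L y) \<le> 1" "(-2/e) * (L z - L y) \<le> 1"
        using z U(3) unfolding N_def L_eq[symmetric] by blast+
      hence "L z * 2 \<le> e + L y * 2" "L y * 2 \<le> e + L z * 2" using e(1) by (auto simp: field_simps)
      hence "\<bar>L z - L y\<bar> \<le> e / 2" by linarith
      hence "L z \<in> ball (L y) e" using e(1) by (simp add: dist_real_def abs_minus_commute)
      thus "z \<in> {x \<in> ?E. L x \<in> S}" using e(2) zE by auto
    qed
    ultimately show "\<exists>N. openin T N \<and> y \<in> N \<and> N \<subseteq> {x \<in> ?E. L x \<in> S}" by blast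
  qed
  hence "continuous_map T euclideanreal L"
    by (auto simp: continuous_map_def)
  with L show ?thesis by (simp add: topological_dual_def)
qed

text \<open>Hahn--Banach applied to the Minkowski functional of a convex neighbourhood of \<open>0\<close>.\<close>

lemma topological_dual_separates:
  fixes T :: "'e::real_vector topology"
  assumes T: "hausdorff_locally_convex_space T" and y: "y \<in> topspace T" "y \<noteq> 0"
  obtains L where "L \<in> topological_dual T" "L y \<noteq> 0"
proof -
  let ?E = "topspace T"
  have E: "subspace ?E" using T unfolding hausdorff_locally_convex_space_def by simp
  note z = subspace_0[OF E]
  \<comment> \<open>Keeping \<open>y\<close> out of \<open>V\<close> is what makes the Minkowski
    functional at least \<open>1\<close> at \<open>y\<close>.\<close>
  have "openin T (?E - {y})"
    using T y(1) unfolding hausdorff_locally_convex_space_def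
    by (intro openin_diff openin_topspace closedin_Hausdorff_singleton) auto
  then obtain U V where U: "openin T U" "0 \<in> U" "U \<subseteq> V" and V: "convex V" "V \<subseteq> ?E - {y}"
    using T y(2) z unfolding hausdorff_locally_convex_space_def neighbourhood_base_of
    by (metis Diff_iff singletonD)
  have V0: "0 \<in> V" using U by auto
  define M where "M x = {t. t > 0 \<and> (1/t) *\<^sub>R x \<in> V}" for x
  define p where "p x = Inf (M x)" for x
  \<comment> \<open>\<open>V\<close> is absorbing: \<open>t \<mapsto> t x\<close> is continuous at
    \<open>0\<close>, so small multiples of \<open>x\<close> lie in \<open>U\<close>.\<close>
  have M_ne: "M x \<noteq> {}" if x: "x \<in> ?E" for x
  proof -
    have "continuous_map euclideanreal T (\<lambda>t. t *\<^sub>R x)"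
      using continuous_map_compose[of euclideanreal "prod_topology euclideanreal T" "\<lambda>t. (t, x)" T
          "\<lambda>(c, x). c *\<^sub>R x"] T x
      unfolding hausdorff_locally_convex_space_def by (simp add: o_def continuous_map_pairwise)
    hence "open {t. t *\<^sub>R x \<in> U}"
      using openin_continuous_map_preimage U(1) by fastforce
    then obtain e where e: "e > 0" "ball 0 e \<subseteq> {t. t *\<^sub>R x \<in> U}"
      using U(2) openE[of "{t. t *\<^sub>R x \<in> U}" "0::real"] by auto
    have "e / 2 \<in> ball 0 e" using e(1) by simp
    hence "(e / 2) *\<^sub>R x \<in> V" using e(2) U(3) by blast
    hence "2 / e \<in> M x" using e(1) by (simp add: M_def)
    thus ?thesis by auto
  qed
  have bdd: "bdd_below (M x)" for x by (rule bdd_belowI[of _ 0]) (auto simp: M_def)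
  have p_le: "p x \<le> t" if "t > 0" "(1/t) *\<^sub>R x \<in> V" for x t
    unfolding p_def by (rule cInf_lower[OF _ bdd]) (use that in \<open>auto simp: M_def\<close>)
  have p_ge: "c \<le> p x" if "x \<in> ?E" "\<And>t. t > 0 \<Longrightarrow> (1/t) *\<^sub>R x \<in> V \<Longrightarrow> c \<le> t" for x c
    unfolding p_def by (rule cInf_greatest[OF M_ne]) (use that in \<open>auto simp: M_def\<close>)
  have sub: "sublinear_on ?E p"
  proof (rule sublinear_onI[OF E])
    fix x w assume x: "x \<in> ?E" and w: "w \<in> ?E"
    have *: "p (x + w) \<le> s + t" if s: "s > 0" "(1/s) *\<^sub>R x \<in> V" and t: "t > 0" "(1/t) *\<^sub>R w \<in> V" for s t
    proof (rule p_le)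
      have "(s / (s+t)) *\<^sub>R ((1/s) *\<^sub>R x) + (t / (s+t)) *\<^sub>R ((1/t) *\<^sub>R w) \<in> V"
        by (rule convexD[OF V(1) s(2) t(2)]) (use s t in \<open>auto simp flip: add_divide_distrib\<close>)
      thus "(1 / (s+t)) *\<^sub>R (x + w) \<in> V" using s t by (simp add: scaleR_right_distrib)
    qed (use s t in simp)
    have "p (x + w) - s \<le> p w" if "s > 0" "(1/s) *\<^sub>R x \<in> V" for s
      by (rule p_ge[OF w]) (use *[OF that] in \<open>auto simp: algebra_simps\<close>)
    hence "p (x + w) - p w \<le> p x"
      by (intro p_ge[OF x]) (auto simp: algebra_simps)
    thus "p (x + w) \<le> p x + p w" by simp
  next
    have "p 0 \<le> 0 + e" if "e > 0" for e
      using p_le[of e 0] that V0 by simp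
    hence "p 0 \<le> 0" by (rule field_le_epsilon)
    moreover have "0 \<le> p 0" by (rule p_ge[OF z]) auto
    ultimately show "p 0 = 0" by simp
  next
    fix c :: real and x assume c: "c > 0" and x: "x \<in> ?E"
    have "p (c *\<^sub>R x) / c \<le> p x"
    proof (rule p_ge[OF x])
      fix t :: real assume t: "t > 0" "(1/t) *\<^sub>R x \<in> V"
      have "p (c *\<^sub>R x) \<le> c * t" by (rule p_le) (use c t in auto)
      thus "p (c *\<^sub>R x) / c \<le> t" using c by (simp add: field_simps)
    qed
    thus "p (c *\<^sub>R x) \<le> c * p x" using c by (simp add: field_simps)
  qed
  obtain L where L: "linear_map_on ?E L" "\<And>x. x \<in> ?E \<Longrightarrow> L x \<le> p x" "L y = p y"
    using hahn_banach[OF E sub y(1)] by metis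
  have "L \<in> topological_dual T"
  proof (rule topological_dualI_bounded_above[OF T L(1) U(1,2)])
    fix x assume "x \<in> U"
    hence "p x \<le> 1" "x \<in> ?E" using p_le[of 1 x] U V by auto
    thus "L x \<le> 1" using L(2) by force
  qed
  moreover have "1 \<le> p y"
  proof (rule p_ge[OF y(1)], rule ccontr)
    fix t :: real assume t: "t > 0" "(1/t) *\<^sub>R y \<in> V" "\<not> 1 \<le> t"
    have "t *\<^sub>R ((1/t) *\<^sub>R y) + (1 - t) *\<^sub>R 0 \<in> V"
      by (rule convexD[OF V(1) t(2) V0]) (use t in auto)
    thus False using t V(2) by auto
  qed
  ultimately show thesis using L(3) by (intro that[of L]) auto
qed

lemma tvs_bounded_dual:
  assumes "tvs_bounded T S" "\<psi> \<in> topological_dual T" "subspace (topspace T)"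
  obtains B where "\<And>x. x \<in> S \<Longrightarrow> \<bar>\<psi> x\<bar> \<le> B"
proof -
  note lin = topological_dual_linear[OF assms(2)]
  have "openin T {x \<in> topspace T. \<psi> x \<in> {-1<..<1}}"
    by (rule openin_continuous_map_preimage[OF topological_dual_continuous[OF assms(2)]]) auto
  moreover have "0 \<in> {x \<in> topspace T. \<psi> x \<in> {-1<..<1}}"
    using linear_map_on_zero[OF lin assms(3)] subspace_0[OF assms(3)] by simp
  ultimately obtain s where s: "s > 0"
    "\<And>t. t > s \<Longrightarrow> S \<subseteq> (\<lambda>x. t *\<^sub>R x) ` {x \<in> topspace T. \<psi> x \<in> {-1<..<1}}"
    using assms(1) unfolding tvs_bounded_def by blast
  have "\<bar>\<psi> x\<bar> \<le> s + 1" if "x \<in> S" for x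
  proof -
    obtain w where w: "w \<in> topspace T" "\<bar>\<psi> w\<bar> < 1" "x = (s + 1) *\<^sub>R w"
      using s(2)[of "s + 1"] \<open>x \<in> S\<close> by auto
    have "\<bar>\<psi> x\<bar> = (s + 1) * \<bar>\<psi> w\<bar>"
      using linear_map_on_scale[OF lin w(1), of "s + 1"] w(3) s(1) by (simp add: abs_mult)
    also have "\<dots> \<le> (s + 1) * 1"
      using w(2) s(1) by (intro mult_left_mono) auto
    finally show ?thesis by simp
  qed
  thus thesis by (rule that)
qed

text \<open>Farkas' lemma up to closure, by Hahn--Banach for the distance to \<open>K\<close> in the seminorm
  \<open>\<Sum>i\<in>I. \<bar>w i\<bar>\<close>.\<close>

lemma cone_approximates:
  fixes K :: "('i \<Rightarrow> real) set"
  assumes I: "finite I"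
    and K: "0 \<in> K" "\<And>k l. k \<in> K \<Longrightarrow> l \<in> K \<Longrightarrow> k + l \<in> K" "\<And>c k. c \<ge> 0 \<Longrightarrow> k \<in> K \<Longrightarrow> c *\<^sub>R k \<in> K"
    and v: "\<And>a. (\<And>k. k \<in> K \<Longrightarrow> 0 \<le> (\<Sum>i\<in>I. a i * k i)) \<Longrightarrow> 0 \<le> (\<Sum>i\<in>I. a i * v i)"
    and e: "e > 0"
  shows "\<exists>k\<in>K. \<forall>i\<in>I. \<bar>k i - v i\<bar> < e"
proof (rule ccontr)
  assume contra: "\<not> ?thesis"
  define n where "n w k = (\<Sum>i\<in>I. \<bar>w i - k i\<bar>)" for w k :: "'i \<Rightarrow> real"
  define p where "p w = (INF k\<in>K. n w k)" for w
  have bdd: "bdd_below (n w ` K)" for w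
    by (rule bdd_belowI2[of _ 0]) (simp add: n_def sum_nonneg)
  have p_le: "p w \<le> n w k" if "k \<in> K" for w k
    unfolding p_def by (rule cINF_lower[OF bdd that])
  have p_ge: "c \<le> p w" if "\<And>k. k \<in> K \<Longrightarrow> c \<le> n w k" for c w
    unfolding p_def by (rule cINF_greatest) (use K that in auto)
  have sub: "sublinear_on UNIV p"
  proof (rule sublinear_onI[OF subspace_UNIV])
    fix w u :: "'i \<Rightarrow> real"
    have *: "p (w + u) \<le> n w k + n u l" if "k \<in> K" "l \<in> K" for k l
    proof -
      have "p (w + u) \<le> n (w + u) (k + l)" by (rule p_le) (use K that in auto)
      also have "\<dots> \<le> n w k + n u l"
        unfolding n_def by (subst sum.distrib[symmetric], rule sum_mono) auto
      finally show ?thesis .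
    qed
    have "p (w + u) - n w k \<le> p u" if "k \<in> K" for k
      by (rule p_ge) (use *[OF that] in \<open>auto simp: algebra_simps\<close>)
    hence "p (w + u) - p u \<le> p w" by (intro p_ge) (auto simp: algebra_simps)
    thus "p (w + u) \<le> p w + p u" by simp
  next
    have "p 0 \<le> n 0 0" by (rule p_le) (rule K)
    moreover have "0 \<le> p 0" by (rule p_ge) (simp add: n_def sum_nonneg)
    ultimately show "p 0 = 0" by (simp add: n_def)
  next
    fix c :: real and w :: "'i \<Rightarrow> real" assume c: "c > 0"
    have "p (c *\<^sub>R w) / c \<le> p w"
    proof (rule p_ge)
      fix k assume "k \<in> K"
      hence "p (c *\<^sub>R w) \<le> n (c *\<^sub>R w) (c *\<^sub>R k)" using c K by (intro p_le) auto
      also have "\<dots> = c * n w k"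
        unfolding n_def sum_distrib_left using c
        by (intro sum.cong) (auto simp: scaleR_fun_def abs_mult simp flip: right_diff_distrib)
      finally show "p (c *\<^sub>R w) / c \<le> n w k" using c by (simp add: field_simps)
    qed
    thus "p (c *\<^sub>R w) \<le> c * p w" using c by (simp add: field_simps)
  qed
  obtain L where L: "linear_map_on UNIV L" "\<And>w. L w \<le> p w" "L v = p v"
    using hahn_banach[OF subspace_UNIV sub] by (metis UNIV_I)
  define b where "b i = (\<lambda>j. if j = i then 1 else 0 :: real)" for i :: 'i
  \<comment> \<open>The seminorm sees only the coordinates in \<open>I\<close>, hence so does
    \<open>L\<close>. It is therefore given by the finitely many coefficients
    \<open>L (b i)\<close>, although the function space may have infinite dimension.\<close>
  have L0: "L w \<le> 0" if "\<And>i. i \<in> I \<Longrightarrow> w i = 0" for w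
    using L(2)[of w] p_le[OF K(1), of w] that by (simp add: n_def)
  have linL: "linear L"
    using L(1) by (intro linearI) (auto simp: linear_map_on_def)
  have L_eq: "L w = (\<Sum>i\<in>I. L (b i) * w i)" for w
  proof -
    define w' where "w' = (\<Sum>i\<in>I. w i *\<^sub>R b i)"
    have "w' j = w j" if "j \<in> I" for j
    proof -
      have "w' j = (\<Sum>i\<in>I. (w i *\<^sub>R b i) j)"
        unfolding w'_def using I by (induction I rule: finite_induct) auto
      also have "\<dots> = (\<Sum>i\<in>I. if i = j then w i else 0)"
        by (intro sum.cong) (auto simp: scaleR_fun_def b_def)
      finally show ?thesis using that I by simp
    qed
    hence "L (w - w') \<le> 0" "L (w' - w) \<le> 0" by (auto intro!: L0)
    hence "L w = L w'" by (simp add: linear_diff[OF linL])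
    also have "\<dots> = (\<Sum>i\<in>I. L (b i) * w i)"
      unfolding w'_def by (simp add: linear_sum[OF linL] linear_scale[OF linL] mult.commute)
    finally show ?thesis .
  qed
  \<comment> \<open>\<open>p\<close> vanishes on \<open>K\<close>, so \<open>- L\<close> is
    admissible in the hypothesis and \<open>L v \<le> 0\<close>. On the other hand
    \<open>L v = p v \<ge> e\<close>, because every \<open>k\<close> in \<open>K\<close> misses
    \<open>v\<close> by at least \<open>e\<close> in some coordinate.\<close>
  have "0 \<le> (\<Sum>i\<in>I. - L (b i) * v i)"
  proof (rule v)
    fix k assume "k \<in> K"
    hence "L k \<le> 0" using L(2)[of k] p_le[of k k] by (simp add: n_def)
    thus "0 \<le> (\<Sum>i\<in>I. - L (b i) * k i)" using L_eq[of k] by (simp add: sum_negf)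
  qed
  hence "L v \<le> 0" using L_eq[of v] by (simp add: sum_negf)
  moreover have "e \<le> p v"
  proof (rule p_ge)
    fix k assume "k \<in> K"
    then obtain i where i: "i \<in> I" "\<bar>k i - v i\<bar> \<ge> e" using contra by (auto simp: not_less)
    have "\<bar>v i - k i\<bar> \<le> n v k"
      unfolding n_def by (rule member_le_sum[OF i(1)]) (use I in auto)
    with i(2) show "e \<le> n v k" by simp
  qed
  ultimately show False using L(3) e by simp
qed

text \<open>The sets of points of \<open>C\<close> that approximate \<open>\<Lambda>\<close> on
  finitely many functionals form a filter base. Its filter is weakly Cauchy, and uniqueness of
  limits in the reals makes the values at its limit exact. This turns the approximate form of
  Farkas' lemma into a point of the cone.\<close>

lemma weakly_complete_approximable:
  assumes C: "C \<subseteq> topspace T" "complete_wrt (weak_uniformity T) C"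
    and approx: "\<And>I e. finite I \<Longrightarrow> I \<subseteq> topological_dual T \<Longrightarrow> e > 0 \<Longrightarrow>
      \<exists>c\<in>C. \<forall>\<psi>\<in>I. \<bar>\<psi> c - \<Lambda> \<psi>\<bar> < e"
  obtains x where "x \<in> C" "\<And>\<psi>. \<psi> \<in> topological_dual T \<Longrightarrow> \<psi> x = \<Lambda> \<psi>"
proof -
  let ?T' = "topological_dual T"
  define B where "B = {(I, e :: real). finite I \<and> I \<subseteq> ?T' \<and> e > 0}"
  define N where "N = (\<lambda>(I, e). {c \<in> C. \<forall>\<psi>\<in>I. \<bar>\<psi> c - \<Lambda> \<psi>\<bar> < e})"
  define F where "F = (INF b\<in>B. principal (N b))"
  \<comment> \<open>With no functional to test, the basic set is all of \<open>C\<close>; this index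
    places the filter on \<open>C\<close>.\<close>
  have B1: "({}, 1) \<in> B" by (simp add: B_def)
  have ev: "eventually P F \<longleftrightarrow> (\<exists>b\<in>B. eventually P (principal (N b)))" for P
    unfolding F_def
  proof (rule eventually_INF_base)
    fix a b assume "a \<in> B" "b \<in> B"
    then obtain I e J d where ab: "a = (I, e)" "b = (J, d)" "(I, e) \<in> B" "(J, d) \<in> B"
      by (metis surj_pair)
    have "(I \<union> J, min e d) \<in> B" "N (I \<union> J, min e d) \<subseteq> N a \<inter> N b"
      using ab by (auto simp: B_def N_def)
    thus "\<exists>x\<in>B. principal (N x) \<le> inf (principal (N a)) (principal (N b))"
      by (intro bexI[of _ "(I \<union> J, min e d)"]) auto
  qed (use B1 in auto)
  have "F \<noteq> bot"
  proof
    assume "F = bot"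
    hence "eventually (\<lambda>_. False) F" by simp
    then obtain I e where "(I, e) \<in> B" "N (I, e) = {}"
      unfolding ev by (auto simp: eventually_principal)
    thus False using approx[of I e] by (auto simp: B_def N_def)
  qed
  have evC: "eventually (\<lambda>c. c \<in> C) F"
    unfolding ev using B1 by (auto simp: eventually_principal N_def)
  have near: "eventually (\<lambda>c. \<bar>\<psi> c - \<Lambda> \<psi>\<bar> < e) F" if "\<psi> \<in> ?T'" "e > 0" for \<psi> e
    unfolding ev
    by (rule bexI[of _ "({\<psi>}, e)"]) (use that in \<open>auto simp: eventually_principal N_def B_def\<close>)
  have FC: "F \<le> principal C"
    using evC by (simp add: le_principal)
  have "F \<times>\<^sub>F F \<le> weak_uniformity T"
    unfolding weak_uniformity_def
  proof (intro le_infI INF_greatest)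
    have "F \<times>\<^sub>F F \<le> principal C \<times>\<^sub>F principal C" using FC by (intro prod_filter_mono)
    also have "\<dots> \<le> principal (topspace T \<times> topspace T)"
      using C(1) by (auto simp: principal_prod_principal)
    finally show "F \<times>\<^sub>F F \<le> principal (topspace T \<times> topspace T)" .
  next
    fix \<psi> assume \<psi>: "\<psi> \<in> ?T'"
    show "F \<times>\<^sub>F F \<le> filtercomap (map_prod \<psi> \<psi>) uniformity"
    proof (rule filter_leI)
      fix P assume "eventually P (filtercomap (map_prod \<psi> \<psi>) uniformity)"
      then obtain Q where Q: "eventually Q (uniformity :: (real \<times> real) filter)"
        "\<And>z. Q (map_prod \<psi> \<psi> z) \<Longrightarrow> P z"
        unfolding eventually_filtercomap by auto
      then obtain e where e: "e > 0" "\<And>x y :: real. dist x y < e \<Longrightarrow> Q (x, y)"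
        unfolding eventually_uniformity_metric by auto
      show "eventually P (F \<times>\<^sub>F F)"
        unfolding eventually_prod_filter
      proof (intro exI conjI allI impI)
        show "eventually (\<lambda>c. \<bar>\<psi> c - \<Lambda> \<psi>\<bar> < e/2) F" "eventually (\<lambda>c. \<bar>\<psi> c - \<Lambda> \<psi>\<bar> < e/2) F"
          using near[OF \<psi>, of "e/2"] e(1) by auto
        fix x y assume "\<bar>\<psi> x - \<Lambda> \<psi>\<bar> < e/2" "\<bar>\<psi> y - \<Lambda> \<psi>\<bar> < e/2"
        hence "dist (\<psi> x) (\<psi> y) < e" unfolding dist_real_def by linarith
        thus "P (x, y)" using e(2) Q(2) by simp
      qed
    qed
  qed
  then obtain x where x: "x \<in> C" "filterlim (\<lambda>y. (x, y)) (weak_uniformity T) F"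
    using C(2) FC \<open>F \<noteq> bot\<close> unfolding complete_wrt_def by blast
  have "\<psi> x = \<Lambda> \<psi>" if \<psi>: "\<psi> \<in> ?T'" for \<psi>
  proof -
    have "weak_uniformity T \<le> filtercomap (map_prod \<psi> \<psi>) uniformity"
      unfolding weak_uniformity_def by (rule le_infI2, rule INF_lower[OF \<psi>])
    hence lim: "filterlim (\<lambda>y. (x, y)) (filtercomap (map_prod \<psi> \<psi>) uniformity) F"
      using x(2) filterlim_mono by blast
    have "(\<psi> \<longlongrightarrow> \<psi> x) F"
    proof (rule tendstoI)
      fix e :: real assume "e > 0"
      hence "eventually (\<lambda>z. dist (fst z) (snd z) < e) (uniformity :: (real \<times> real) filter)"
        unfolding eventually_uniformity_metric by auto
      hence "eventually (\<lambda>z. dist (fst (map_prod \<psi> \<psi> z)) (snd (map_prod \<psi> \<psi> z)) < e)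
               (filtercomap (map_prod \<psi> \<psi>) uniformity)"
        by (rule eventually_filtercomapI)
      from filterlim_iff[THEN iffD1, OF lim, rule_format, OF this]
      show "eventually (\<lambda>y. dist (\<psi> y) (\<psi> x) < e) F" by (simp add: dist_commute)
    qed
    moreover have "(\<psi> \<longlongrightarrow> \<Lambda> \<psi>) F"
      by (rule tendstoI) (use near[OF \<psi>] in \<open>simp add: dist_real_def\<close>)
    ultimately show ?thesis using \<open>F \<noteq> bot\<close> tendsto_unique by blast
  qed
  with x(1) show thesis by (rule that)
qed

section \<open>Dominated functions and invariant integrals\<close>

lemma linear_map_on_sum:
  assumes "linear_map_on E f" "subspace E" "finite I" "\<And>i. i \<in> I \<Longrightarrow> h i \<in> E"
  shows "f (\<Sum>i\<in>I. c i *\<^sub>R h i) = (\<Sum>i\<in>I. c i *\<^sub>R f (h i))"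
  using assms(3,4)
proof (induction I rule: finite_induct)
  case empty
  show ?case using linear_map_on_zero[OF assms(1,2)] by simp
next
  case (insert j I)
  have "(\<Sum>i\<in>I. c i *\<^sub>R h i) \<in> E"
    using insert.prems by (intro subspace_sum subspace_scale assms(2)) auto
  hence "f (c j *\<^sub>R h j + (\<Sum>i\<in>I. c i *\<^sub>R h i)) = c j *\<^sub>R f (h j) + f (\<Sum>i\<in>I. c i *\<^sub>R h i)"
    using insert.prems assms(1,2)
    by (simp add: linear_map_on_add linear_map_on_scale subspace_scale)
  with insert show ?case by simp
qed

lemma sum_list_fun_apply: "(\<Sum>x\<leftarrow>xs. F x) y = (\<Sum>x\<leftarrow>xs. (F x y :: real))"
  by (induction xs) auto

section \<open>Bounded functions and their translates\<close>

lemma bounded_functions_iff: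
  "f \<in> bounded_functions G \<longleftrightarrow>
     (\<exists>B. \<forall>x\<in>carrier G. \<bar>f x\<bar> \<le> B) \<and> (\<forall>x. x \<notin> carrier G \<longrightarrow> f x = 0)"
  unfolding bounded_functions_def bounded_iff by auto

lemma bounded_functionsI:
  assumes "\<And>x. x \<in> carrier G \<Longrightarrow> \<bar>f x\<bar> \<le> B" "\<And>x. x \<notin> carrier G \<Longrightarrow> f x = 0"
  shows "f \<in> bounded_functions G"
  using assms unfolding bounded_functions_iff by blast

lemma subspace_bounded_functions: "subspace (bounded_functions G)"
proof (rule subspaceI)
  show "0 \<in> bounded_functions G" by (rule bounded_functionsI[of _ _ 0]) auto
next
  fix f h assume "f \<in> bounded_functions G" "h \<in> bounded_functions G"
  then obtain B C where "\<And>x. x \<in> carrier G \<Longrightarrow> \<bar>f x\<bar> \<le> B" "\<And>x. x \<in> carrier G \<Longrightarrow> \<bar>h x\<bar> \<le> C"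
    and "\<And>x. x \<notin> carrier G \<Longrightarrow> f x = 0 \<and> h x = 0"
    unfolding bounded_functions_iff by blast
  thus "f + h \<in> bounded_functions G"
    by (intro bounded_functionsI[of _ _ "B + C"]) (force intro: order_trans[OF abs_triangle_ineq])+
next
  fix c f assume "f \<in> bounded_functions G"
  then obtain B where "\<And>x. x \<in> carrier G \<Longrightarrow> \<bar>f x\<bar> \<le> B" "\<And>x. x \<notin> carrier G \<Longrightarrow> f x = 0"
    unfolding bounded_functions_iff by blast
  thus "c *\<^sub>R f \<in> bounded_functions G"
    by (intro bounded_functionsI[of _ _ "\<bar>c\<bar> * B"]) (auto simp: scaleR_fun_def abs_mult mult_left_mono)
qed

lemma bounded_functions_dominated:
  assumes "h \<in> bounded_functions G" "\<And>x. \<bar>k x\<bar> \<le> h x"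
  shows "k \<in> bounded_functions G"
proof -
  obtain B where B: "\<And>x. x \<in> carrier G \<Longrightarrow> \<bar>h x\<bar> \<le> B" "\<And>x. x \<notin> carrier G \<Longrightarrow> h x = 0"
    using assms(1) unfolding bounded_functions_iff by blast
  show ?thesis
  proof (rule bounded_functionsI)
    show "\<bar>k x\<bar> \<le> B" if "x \<in> carrier G" for x
      using B(1)[OF that] assms(2)[of x] by linarith
    show "k x = 0" if "x \<notin> carrier G" for x
      using B(2)[OF that] assms(2)[of x] by simp
  qed
qed

lemma left_translate_linear:
  "left_translate G g (f + h) = left_translate G g f + left_translate G g h"
  "left_translate G g (f - h) = left_translate G g f - left_translate G g h"
  "left_translate G g (c *\<^sub>R f) = c *\<^sub>R left_translate G g f"
  "left_translate G g 0 = 0"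
  by (auto simp: left_translate_def scaleR_fun_def fun_eq_iff)

lemma left_translate_mono: "f \<le> h \<Longrightarrow> left_translate G g f \<le> left_translate G g h"
  by (auto simp: left_translate_def le_fun_def)

lemma left_translate_nonneg: "0 \<le> f \<Longrightarrow> 0 \<le> left_translate G g f"
  using left_translate_mono[of 0 f G g] by (simp add: left_translate_linear)

lemma (in group) left_translate_bounded:
  assumes "g \<in> carrier G" "f \<in> bounded_functions G"
  shows "left_translate G g f \<in> bounded_functions G"
proof -
  obtain B where "\<And>x. x \<in> carrier G \<Longrightarrow> \<bar>f x\<bar> \<le> B"
    using assms unfolding bounded_functions_iff by blast
  thus ?thesis
    using assms(1) by (intro bounded_functionsI[of _ _ B]) (auto simp: left_translate_def)
qed

lemma (in group) left_translate_mult: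
  assumes "g \<in> carrier G" "h \<in> carrier G"
  shows "left_translate G g (left_translate G h f) = left_translate G (g \<otimes> h) f"
  using assms by (auto simp: left_translate_def fun_eq_iff inv_mult_group m_assoc)

lemma (in group) left_translate_one:
  assumes "f \<in> bounded_functions G"
  shows "left_translate G \<one> f = f"
  using assms by (auto simp: left_translate_def fun_eq_iff bounded_functions_iff)

text \<open>A list allows the same translate to occur several times. Repetition is how the dominated
  functions become closed under multiplication by large scalars.\<close>

definition translate_sum ::
    "('g, 'm) monoid_scheme \<Rightarrow> ('g \<Rightarrow> real) \<Rightarrow> 'g list \<Rightarrow> 'g \<Rightarrow> real" where
  "translate_sum G f gs = (\<Sum>g\<leftarrow>gs. left_translate G g f)"

lemma translate_sum_simps [simp]:
  "translate_sum G f [] = 0"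
  "translate_sum G f (g # gs) = left_translate G g f + translate_sum G f gs"
  "translate_sum G f (gs @ hs) = translate_sum G f gs + translate_sum G f hs"
  by (auto simp: translate_sum_def)

lemma translate_sum_nonneg: "0 \<le> f \<Longrightarrow> 0 \<le> translate_sum G f gs"
  by (induction gs) (auto intro: add_nonneg_nonneg left_translate_nonneg)

lemma (in group) translate_sum_bounded:
  assumes "f \<in> bounded_functions G" "set gs \<subseteq> carrier G"
  shows "translate_sum G f gs \<in> bounded_functions G"
  using assms(2)
proof (induction gs)
  case Nil
  show ?case unfolding translate_sum_simps by (rule subspace_0[OF subspace_bounded_functions])
next
  case (Cons g gs)
  thus ?case
    unfolding translate_sum_simps
    by (intro subspace_add[OF subspace_bounded_functions] left_translate_bounded assms(1)) auto
qed

lemma (in group) left_translate_translate_sum: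
  assumes "g \<in> carrier G" "set gs \<subseteq> carrier G"
  shows "left_translate G g (translate_sum G f gs) = translate_sum G f (map ((\<otimes>) g) gs)"
  using assms(2) assms(1)
  by (induction gs) (auto simp: left_translate_linear left_translate_mult)

text \<open>The smallest translation-invariant solid subspace containing \<open>f\<close>.\<close>

definition dominated_functions ::
    "('g, 'm) monoid_scheme \<Rightarrow> ('g \<Rightarrow> real) \<Rightarrow> ('g \<Rightarrow> real) set" where
  "dominated_functions G f =
     {h. \<exists>gs. set gs \<subseteq> carrier G \<and> (\<forall>x. \<bar>h x\<bar> \<le> translate_sum G f gs x)}"

lemma (in group) dominated_functions_bounded:
  assumes "f \<in> bounded_functions G" "h \<in> dominated_functions G f"
  shows "h \<in> bounded_functions G"
  using assms bounded_functions_dominated[OF translate_sum_bounded]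
  unfolding dominated_functions_def by blast

lemma subspace_dominated_functions:
  assumes "0 \<le> f"
  shows "subspace (dominated_functions G f)"
proof (rule subspaceI)
  show "0 \<in> dominated_functions G f"
    unfolding dominated_functions_def by (auto intro!: exI[of _ "[]"])
next
  fix h k assume "h \<in> dominated_functions G f" "k \<in> dominated_functions G f"
  then obtain gs hs where "set gs \<subseteq> carrier G" "\<And>x. \<bar>h x\<bar> \<le> translate_sum G f gs x"
    "set hs \<subseteq> carrier G" "\<And>x. \<bar>k x\<bar> \<le> translate_sum G f hs x"
    unfolding dominated_functions_def by blast
  thus "h + k \<in> dominated_functions G f"
    unfolding dominated_functions_def
    by (auto intro!: exI[of _ "gs @ hs"] order_trans[OF abs_triangle_ineq] add_mono)
next
  fix c h assume "h \<in> dominated_functions G f"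
  then obtain gs where gs: "set gs \<subseteq> carrier G" "\<And>x. \<bar>h x\<bar> \<le> translate_sum G f gs x"
    unfolding dominated_functions_def by blast
  obtain n :: nat where n: "\<bar>c\<bar> \<le> real n" using real_arch_simple by blast
  have "\<bar>(c *\<^sub>R h) x\<bar> \<le> translate_sum G f (concat (replicate n gs)) x" for x
  proof -
    have "\<bar>(c *\<^sub>R h) x\<bar> = \<bar>c\<bar> * \<bar>h x\<bar>" by (simp add: scaleR_fun_def abs_mult)
    also have "\<dots> \<le> real n * translate_sum G f gs x" by (intro mult_mono n gs) auto
    also have "\<dots> = translate_sum G f (concat (replicate n gs)) x"
      by (induction n) (auto simp: algebra_simps)
    finally show ?thesis .
  qed
  moreover have "set (concat (replicate n gs)) \<subseteq> carrier G" using gs(1) by auto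
  ultimately show "c *\<^sub>R h \<in> dominated_functions G f"
    unfolding dominated_functions_def by blast
qed

lemma dominated_functions_solid:
  assumes "h \<in> dominated_functions G f" "\<And>x. \<bar>k x\<bar> \<le> \<bar>h x\<bar>"
  shows "k \<in> dominated_functions G f"
  using assms unfolding dominated_functions_def by (blast intro: order_trans)

lemma translate_sum_dominated:
  assumes "0 \<le> f" "set gs \<subseteq> carrier G"
  shows "translate_sum G f gs \<in> dominated_functions G f"
  using translate_sum_nonneg[OF assms(1), of G gs] assms(2)
  unfolding dominated_functions_def le_fun_def by (auto intro!: exI[of _ gs])

lemma (in group) self_dominated:
  assumes "0 \<le> f" "f \<in> bounded_functions G"
  shows "f \<in> dominated_functions G f"
  using translate_sum_dominated[OF assms(1), of "[\<one>]" G] left_translate_one[OF assms(2)] by simp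

lemma (in group) left_translate_dominated:
  assumes "g \<in> carrier G" "h \<in> dominated_functions G f"
  shows "left_translate G g h \<in> dominated_functions G f"
proof -
  obtain gs where gs: "set gs \<subseteq> carrier G" "\<And>x. \<bar>h x\<bar> \<le> translate_sum G f gs x"
    using assms(2) unfolding dominated_functions_def by blast
  have "\<bar>left_translate G g h x\<bar> \<le> left_translate G g (translate_sum G f gs) x" for x
    using gs(2) by (auto simp: left_translate_def)
  moreover have "set (map ((\<otimes>) g) gs) \<subseteq> carrier G" using assms(1) gs(1) by auto
  ultimately show ?thesis
    unfolding dominated_functions_def left_translate_translate_sum[OF assms(1) gs(1)] by blast
qed

text \<open>The domain is only the space dominated by \<open>f\<close>, since finiteness on all
  bounded functions cannot be expected: for a point mass \<open>f\<close> on an infinite group, the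
  integral is a multiple of summation over finitely supported functions.\<close>

definition invariant_integral ::
    "('g, 'm) monoid_scheme \<Rightarrow> ('g \<Rightarrow> real) \<Rightarrow> (('g \<Rightarrow> real) \<Rightarrow> real) \<Rightarrow> bool" where
  "invariant_integral G f \<mu> \<longleftrightarrow>
     linear_map_on (dominated_functions G f) \<mu> \<and>
     (\<forall>h\<in>dominated_functions G f. 0 \<le> h \<longrightarrow> 0 \<le> \<mu> h) \<and>
     (\<forall>g\<in>carrier G. \<forall>h\<in>dominated_functions G f. \<mu> (left_translate G g h) = \<mu> h) \<and>
     0 < \<mu> f"

text \<open>Cauchy's functional equation under monotonicity: squeezing \<open>n * t\<close> between
  consecutive integers bounds \<open>n * \<bar>F t - t * F 1\<bar>\<close> by \<open>F 1\<close> for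
  every \<open>n\<close>, so the difference is \<open>0\<close>.\<close>

lemma nonneg_additive_imp_homogeneous:
  fixes F :: "real \<Rightarrow> real"
  assumes add: "\<And>s t. s \<ge> 0 \<Longrightarrow> t \<ge> 0 \<Longrightarrow> F (s + t) = F s + F t"
    and nonneg: "\<And>t. t \<ge> 0 \<Longrightarrow> 0 \<le> F t" and t: "t \<ge> 0"
  shows "F t = t * F 1"
proof -
  have mono: "F s \<le> F t" if "0 \<le> s" "s \<le> t" for s t
    using add[of s "t - s"] nonneg[of "t - s"] that by simp
  have mult: "F (real n * s) = real n * F s" if "s \<ge> 0" for n s
  proof (induction n)
    case 0
    show ?case using add[of 0 0] by simp
  next
    case (Suc n)
    have "F (real n * s + s) = F (real n * s) + F s" by (rule add) (use that in auto)
    with Suc show ?case by (simp add: algebra_simps)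
  qed
  have "real n * \<bar>F t - t * F 1\<bar> \<le> F 1" for n
  proof -
    define k where "k = nat \<lfloor>real n * t\<rfloor>"
    have k: "real k \<le> real n * t" "real n * t \<le> real k + 1"
      using t by (simp_all add: k_def)
    have "F (real k * 1) \<le> F (real n * t)" by (rule mono) (use k in auto)
    moreover have "F (real n * t) \<le> F (real (Suc k) * 1)"
      by (rule mono) (use k t in auto)
    ultimately have "real k * F 1 \<le> real n * F t" "real n * F t \<le> (real k + 1) * F 1"
      using mult[of 1 k] mult[of 1 "Suc k"] mult[OF t, of n] by (simp_all add: algebra_simps)
    moreover have "real k * F 1 \<le> real n * t * F 1" "real n * t * F 1 \<le> (real k + 1) * F 1"
      using k nonneg[of 1] by (auto intro!: mult_right_mono)
    ultimately have "\<bar>real n * F t - real n * t * F 1\<bar> \<le> F 1"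
      by (simp add: algebra_simps abs_le_iff)
    also have "real n * F t - real n * t * F 1 = real n * (F t - t * F 1)"
      by (simp add: algebra_simps)
    finally show ?thesis by (simp add: abs_mult)
  qed
  hence "\<bar>F t - t * F 1\<bar> \<le> 0"
    using reals_Archimedean3 by (metis abs_ge_zero less_eq_real_def not_le)
  thus ?thesis by simp
qed

text \<open>The extension takes the difference of the values at the positive and negative parts. The
  same value results from every decomposition \<open>a - b\<close> into non-negative functions,
  because \<open>P (a - b) + b = a + P (b - a)\<close>; this reduces linearity to additivity and
  homogeneity of \<open>m\<close> on non-negative functions.\<close>

lemma positive_additive_extends:
  fixes D :: "('g \<Rightarrow> real) set"
  assumes D: "subspace D" and pos: "\<And>h. h \<in> D \<Longrightarrow> (\<lambda>x. max (h x) 0) \<in> D"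
    and add: "\<And>h k. h \<in> D \<Longrightarrow> k \<in> D \<Longrightarrow> 0 \<le> h \<Longrightarrow> 0 \<le> k \<Longrightarrow> m (h + k) = m h + m k"
    and nonneg: "\<And>h. h \<in> D \<Longrightarrow> 0 \<le> h \<Longrightarrow> 0 \<le> (m h :: real)"
  obtains \<mu> where "linear_map_on D \<mu>" "\<And>h. h \<in> D \<Longrightarrow> 0 \<le> h \<Longrightarrow> \<mu> h = m h"
proof -
  define P where "P h = (\<lambda>x. max (h x) 0)" for h :: "'g \<Rightarrow> real"
  define \<mu> where "\<mu> h = m (P h) - m (P (- h))" for h
  have PD: "P h \<in> D" "P (- h) \<in> D" "0 \<le> P h" if "h \<in> D" for h
    using pos[OF that] pos[OF subspace_neg[OF D that]] by (auto simp: P_def le_fun_def)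
  have P0: "0 \<le> P h" for h by (auto simp: P_def le_fun_def)
  have \<mu>_diff: "\<mu> (a - b) = m a - m b" if ab: "a \<in> D" "b \<in> D" "0 \<le> a" "0 \<le> b" for a b
  proof -
    have h: "a - b \<in> D" using subspace_diff[OF D] ab by simp
    have "P (a - b) + b = a + P (- (a - b))" by (auto simp: P_def fun_eq_iff)
    hence "m (P (a - b) + b) = m (a + P (- (a - b)))" by simp
    hence "m (P (a - b)) + m b = m a + m (P (- (a - b)))"
      using add PD[OF h] ab P0 by metis
    thus ?thesis by (simp add: \<mu>_def)
  qed
  have split: "h = P h - P (- h)" for h by (auto simp: P_def fun_eq_iff)
  have m0: "m 0 = 0" using add[of 0 0] subspace_0[OF D] by simp
  have ext: "\<mu> h = m h" if "h \<in> D" "0 \<le> h" for h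
    using \<mu>_diff[of h 0] that subspace_0[OF D] m0 by simp
  have \<mu>_add: "\<mu> (h + k) = \<mu> h + \<mu> k" if hk: "h \<in> D" "k \<in> D" for h k
  proof -
    have "h + k = (P h + P k) - (P (- h) + P (- k))"
      by (subst (1) split[of h], subst (1) split[of k]) (simp add: algebra_simps)
    hence "\<mu> (h + k) = \<mu> ((P h + P k) - (P (- h) + P (- k)))" by simp
    also have "\<dots> = m (P h + P k) - m (P (- h) + P (- k))"
      using PD hk P0 by (intro \<mu>_diff subspace_add[OF D] add_nonneg_nonneg) auto
    also have "\<dots> = \<mu> h + \<mu> k"
      using add PD hk P0 by (simp add: \<mu>_def)
    finally show ?thesis .
  qed
  have m_scale: "m (c *\<^sub>R h) = c * m h" if "c \<ge> 0" "h \<in> D" "0 \<le> h" for c h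
  proof -
    have h0: "0 \<le> t *\<^sub>R h" if "t \<ge> 0" for t
      using that \<open>0 \<le> h\<close> by (auto simp: scaleR_fun_def le_fun_def)
    have "m (c *\<^sub>R h) = c * m (1 *\<^sub>R h)"
    proof (rule nonneg_additive_imp_homogeneous[of "\<lambda>t. m (t *\<^sub>R h)"])
      show "m ((s + t) *\<^sub>R h) = m (s *\<^sub>R h) + m (t *\<^sub>R h)" if "s \<ge> 0" "t \<ge> 0" for s t
        unfolding scaleR_add_left using h0 that \<open>h \<in> D\<close> by (intro add subspace_scale[OF D])
    qed (use h0 \<open>h \<in> D\<close> in \<open>auto intro!: nonneg subspace_scale[OF D] simp: \<open>c \<ge> 0\<close>\<close>)
    thus ?thesis by simp
  qed
  have \<mu>_scale: "\<mu> (c *\<^sub>R h) = c * \<mu> h" if h: "h \<in> D" for c h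
  proof (cases "c \<ge> 0")
    case True
    have "c *\<^sub>R h = c *\<^sub>R P h - c *\<^sub>R P (- h)"
      by (subst (1) split) (simp add: scaleR_diff_right)
    hence "\<mu> (c *\<^sub>R h) = \<mu> (c *\<^sub>R P h - c *\<^sub>R P (- h))" by simp
    also have "\<dots> = m (c *\<^sub>R P h) - m (c *\<^sub>R P (- h))"
      using PD[OF h] P0 True
      by (intro \<mu>_diff subspace_scale[OF D]) (auto simp: scaleR_fun_def le_fun_def)
    also have "\<dots> = c * \<mu> h"
      using PD[OF h] P0 True m_scale by (simp add: \<mu>_def algebra_simps)
    finally show ?thesis .
  next
    case False
    have "c *\<^sub>R h = (- c) *\<^sub>R P (- h) - (- c) *\<^sub>R P h"
      by (subst (1) split) (simp add: scaleR_diff_right)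
    hence "\<mu> (c *\<^sub>R h) = \<mu> ((- c) *\<^sub>R P (- h) - (- c) *\<^sub>R P h)" by simp
    also have "\<dots> = m ((- c) *\<^sub>R P (- h)) - m ((- c) *\<^sub>R P h)"
      using PD[OF h] P0 False
      by (intro \<mu>_diff subspace_scale[OF D]) (auto simp: scaleR_fun_def le_fun_def mult_nonpos_nonneg)
    also have "\<dots> = c * \<mu> h"
      using PD[OF h] P0 False m_scale[of "- c"] by (simp add: \<mu>_def algebra_simps)
    finally show ?thesis .
  qed
  show thesis
    by (rule that[of \<mu>]) (use \<mu>_add \<mu>_scale ext in \<open>auto simp: linear_map_on_def\<close>)
qed

section \<open>From conditional means to invariant integrals\<close>

text \<open>The integral normalised at \<open>f\<close> is \<open>h \<mapsto> P h H / P f H\<close> for any \<open>H\<close> above \<open>f\<close> and \<open>h\<close>. The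
  denominator is positive: if \<open>H\<close> is a sum of \<open>n\<close> translates of \<open>f\<close> then \<open>1 = P H H = n * P f H\<close>.\<close>

lemma (in group) invariant_conditional_mean_imp_integral:
  assumes P: "invariant_conditional_mean G P"
    and f: "f \<in> bounded_functions G" "0 \<le> f" "f \<noteq> 0"
  shows "\<exists>\<mu>. invariant_integral G f \<mu>"
proof -
  let ?B = "bounded_functions G" and ?D = "dominated_functions G f"
  note B = subspace_bounded_functions[of G] and D = subspace_dominated_functions[OF f(2), of G]
  note DB = dominated_functions_bounded[OF f(1)]
  note fD = self_dominated[OF f(2,1)]
  have P_nonneg: "0 \<le> P h H" if "h \<in> ?B" "H \<in> ?B" "0 \<le> h" "h \<le> H" "H \<noteq> 0" for h H
    using P that unfolding invariant_conditional_mean_def conditional_mean_def conditional_pair_def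
    by blast
  have P_add: "P (h + k) H = P h H + P k H"
    if "h \<in> ?B" "k \<in> ?B" "H \<in> ?B" "0 \<le> h" "0 \<le> k" "h + k \<le> H" "H \<noteq> 0" for h k H
    using P that unfolding invariant_conditional_mean_def conditional_mean_def by blast
  have P_mult: "P h H = P h k * P k H"
    if "h \<in> ?B" "k \<in> ?B" "H \<in> ?B" "0 \<le> h" "h \<le> k" "k \<le> H" "k \<noteq> 0" for h k H
    using P that unfolding invariant_conditional_mean_def conditional_mean_def by blast
  have P_self: "P H H = 1" if "H \<in> ?B" "0 \<le> H" "H \<noteq> 0" for H
    using P that unfolding invariant_conditional_mean_def conditional_mean_def by blast
  have P_inv: "P (left_translate G g h) H = P h H"
    if "g \<in> carrier G" "h \<in> ?B" "H \<in> ?B" "0 \<le> h" "h \<le> H" "H \<noteq> 0" "left_translate G g h \<le> H" for g h H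
    using P that unfolding invariant_conditional_mean_def conditional_pair_def by blast
  \<comment> \<open>The admissible second arguments are those above \<open>f\<close> but of the same
    order of magnitude, which is where \<open>P f H\<close> cannot vanish.\<close>
  define adm where "adm H \<longleftrightarrow> f \<le> H \<and> H \<in> ?D" for H
  have admD: "f \<le> H" "H \<in> ?D" "H \<in> ?B" "0 \<le> H" "H \<noteq> 0" if "adm H" for H
  proof -
    show *: "f \<le> H" "H \<in> ?D" "H \<in> ?B" using that DB by (auto simp: adm_def)
    show "0 \<le> H" using f(2) *(1) by (rule order_trans)
    show "H \<noteq> 0" using f *(1) by auto
  qed
  have P_sum: "P (translate_sum G f gs) H = real (length gs) * P f H"
    if H: "adm H" and gs: "set gs \<subseteq> carrier G" "translate_sum G f gs \<le> H" for gs H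
    using gs
  proof (induction gs)
    case Nil
    have "P (0 + 0) H = P 0 H + P 0 H"
      using admD[OF H] subspace_0[OF B] by (intro P_add) auto
    hence "P 0 H = 0" by simp
    thus ?case unfolding translate_sum_simps by (simp only: list.size of_nat_0 mult_zero_left)
  next
    case (Cons g gs)
    have g: "g \<in> carrier G" and gs: "set gs \<subseteq> carrier G" using Cons.prems by auto
    let ?t = "left_translate G g f" and ?s = "translate_sum G f gs"
    have nn: "0 \<le> ?t" "0 \<le> ?s" by (auto intro: left_translate_nonneg translate_sum_nonneg f)
    have "?t + ?s \<le> H" using Cons.prems(2) unfolding translate_sum_simps .
    moreover from this nn have le: "?t \<le> H" "?s \<le> H"
      by (auto elim!: order_trans[rotated])
    ultimately have "P (?t + ?s) H = P ?t H + P ?s H"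
      using admD[OF H] nn by (intro P_add left_translate_bounded translate_sum_bounded f g gs)
    also have "P ?t H = P f H"
      using admD[OF H] le f g by (intro P_inv)
    finally show ?case
      using Cons.IH[OF gs le(2)] unfolding translate_sum_simps by (simp add: algebra_simps)
  qed
  have P_pos: "P f H > 0" if H: "adm H" for H
  proof -
    obtain gs where gs: "set gs \<subseteq> carrier G" "\<And>x. \<bar>H x\<bar> \<le> translate_sum G f gs x"
      using admD(2)[OF H] unfolding dominated_functions_def by blast
    \<comment> \<open>An arbitrary admissible \<open>H\<close> is placed below a sum of translates
      \<open>H'\<close>. By (CM2), \<open>P f H\<close> is then a factor of the non-zero number
      \<open>P f H'\<close>.\<close>
    define H' where "H' = translate_sum G f (\<one> # gs)"
    have H'_eq: "H' = f + translate_sum G f gs"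
      unfolding H'_def translate_sum_simps left_translate_one[OF f(1)] ..
    have "H \<le> translate_sum G f gs"
      using gs(2) by (auto simp: le_fun_def intro: order_trans[OF abs_ge_self])
    hence le: "H \<le> H'" using add_mono[OF f(2)] unfolding H'_eq by force
    have H': "adm H'"
      unfolding adm_def
    proof
      show "f \<le> H'" using admD(1)[OF H] le by (rule order_trans)
      show "H' \<in> ?D" unfolding H'_def by (rule translate_sum_dominated) (use f gs(1) in auto)
    qed
    have "1 = P H' H'" using P_self admD[OF H'] by simp
    also have "\<dots> = real (length (\<one> # gs)) * P f H'"
      unfolding H'_def by (rule P_sum) (use H' gs in \<open>simp_all add: H'_def\<close>)
    finally have "P f H' \<noteq> 0" by auto
    moreover have "P f H' = P f H * P H H'"
      using admD[OF H] admD[OF H'] f le by (intro P_mult)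
    ultimately have "P f H \<noteq> 0" by auto
    moreover have "0 \<le> P f H" using admD[OF H] f by (intro P_nonneg)
    ultimately show ?thesis by simp
  qed
  define R where "R h H = P h H / P f H" for h H
  \<comment> \<open>By (CM2), enlarging \<open>H\<close> multiplies numerator and denominator by the
    same \<open>P H H'\<close>. Two admissible choices therefore agree, by comparison with their
    sum.\<close>
  have R_mono: "R h H' = R h H" if H: "adm H" "adm H'" "H \<le> H'" and h: "h \<in> ?D" "0 \<le> h" "h \<le> H" for h H H'
  proof -
    have "P f H' = P f H * P H H'" "P h H' = P h H * P H H'"
      using admD[OF H(1)] admD[OF H(2)] H f h DB by (intro P_mult; simp)+
    moreover have "P f H' > 0" by (rule P_pos[OF H(2)])
    ultimately show ?thesis unfolding R_def by auto
  qed
  define m where "m h = R h (SOME H. adm H \<and> h \<le> H)" for h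
  have m_eq: "m h = R h H" if H: "adm H" and h: "h \<in> ?D" "0 \<le> h" "h \<le> H" for h H
  proof -
    define K where "K = (SOME H. adm H \<and> h \<le> H)"
    have K: "adm K \<and> h \<le> K" unfolding K_def by (rule someI[of _ H]) (use H h in simp)
    have le: "H \<le> H + K" "K \<le> H + K"
      using admD(4)[OF H] admD(4)[of K] K by auto
    have HK: "adm (H + K)"
      using admD[OF H] admD(2)[of K] K le(1) D unfolding adm_def by (auto intro: subspace_add order_trans)
    have "m h = R h K" by (simp add: m_def K_def)
    also have "\<dots> = R h (H + K)" using R_mono[OF _ HK le(2), of h] K h by simp
    also have "\<dots> = R h H" using R_mono[OF H HK le(1), of h] h by simp
    finally show ?thesis .
  qed
  \<comment> \<open>Adding \<open>f\<close> to a non-negative function gives a second argument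
    admissible for everything below it.\<close>
  have adm_add: "adm (h + f)" if "h \<in> ?D" "0 \<le> h" for h
    using that fD D unfolding adm_def by (auto intro: subspace_add)
  have m_add: "m (h + k) = m h + m k" if hk: "h \<in> ?D" "k \<in> ?D" "0 \<le> h" "0 \<le> k" for h k
  proof -
    let ?H = "h + k + f"
    have hkD: "h + k \<in> ?D" "0 \<le> h + k" using hk D by (auto intro: subspace_add add_nonneg_nonneg)
    note H = adm_add[OF hkD]
    have "h + k \<le> ?H" "h \<le> h + k" "k \<le> h + k"
      using hk f(2) by auto
    hence le: "h + k \<le> ?H" "h \<le> ?H" "k \<le> ?H"
      by (auto intro: order_trans simp del: plus_fun_apply)
    have "P (h + k) ?H = P h ?H + P k ?H"
      using admD[OF H] hk DB le by (intro P_add) auto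
    thus ?thesis
      using m_eq[OF H hkD le(1)] m_eq[OF H hk(1,3) le(2)] m_eq[OF H hk(2,4) le(3)]
      by (simp add: R_def add_divide_distrib)
  qed
  have m_nonneg: "0 \<le> m h" if h: "h \<in> ?D" "0 \<le> h" for h
  proof -
    note H = adm_add[OF h]
    have le: "h \<le> h + f" using f by auto
    have "0 \<le> P h (h + f)" using admD[OF H] h DB le by (intro P_nonneg) auto
    thus ?thesis using m_eq[OF H h le] P_pos[OF H] by (simp add: R_def)
  qed
  have m_inv: "m (left_translate G g h) = m h" if g: "g \<in> carrier G" and h: "h \<in> ?D" "0 \<le> h" for g h
  proof -
    let ?t = "left_translate G g h"
    have t: "?t \<in> ?D" "0 \<le> ?t"
      using g h by (auto intro: left_translate_dominated left_translate_nonneg)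
    have th: "?t + h \<in> ?D" "0 \<le> ?t + h" using t h D by (auto intro: subspace_add add_nonneg_nonneg)
    note H = adm_add[OF th]
    have "?t + h \<le> ?t + h + f" "?t \<le> ?t + h" "h \<le> ?t + h"
      using t h f(2) by auto
    hence le: "?t \<le> ?t + h + f" "h \<le> ?t + h + f"
      by (auto intro: order_trans simp del: plus_fun_apply)
    have "P ?t (?t + h + f) = P h (?t + h + f)"
      using admD[OF H] h DB le g by (intro P_inv) auto
    thus ?thesis using m_eq[OF H t le(1)] m_eq[OF H h le(2)] by (simp add: R_def)
  qed
  have pos_D: "(\<lambda>x. max (h x) 0) \<in> ?D" if "h \<in> ?D" for h
    by (rule dominated_functions_solid[OF that]) auto
  obtain \<mu> where \<mu>: "linear_map_on ?D \<mu>" "\<And>h. h \<in> ?D \<Longrightarrow> 0 \<le> h \<Longrightarrow> \<mu> h = m h"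
    using positive_additive_extends[OF D pos_D m_add m_nonneg] by blast
  \<comment> \<open>Invariance is known on non-negative functions; it passes to \<open>h\<close> by
    cancelling the negative part \<open>b\<close> in \<open>h + b = a\<close>.\<close>
  have "\<mu> (left_translate G g h) = \<mu> h" if g: "g \<in> carrier G" and h: "h \<in> ?D" for g h
  proof -
    define a b where "a = (\<lambda>x. max (h x) 0)" and "b = (\<lambda>x. max ((- h) x) 0)"
    have ab: "a \<in> ?D" "b \<in> ?D" "0 \<le> a" "0 \<le> b" "h + b = a"
      using pos_D[OF h] pos_D[OF subspace_neg[OF D h]]
      by (auto simp: a_def b_def le_fun_def fun_eq_iff)
    have "\<mu> (left_translate G g h) + \<mu> (left_translate G g b) = \<mu> (left_translate G g a)"
      unfolding ab(5)[symmetric] left_translate_linear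
      by (intro linear_map_on_add[OF \<mu>(1), symmetric] left_translate_dominated g h ab)
    moreover have "\<mu> h + \<mu> b = \<mu> a"
      using linear_map_on_add[OF \<mu>(1) h ab(2)] ab(5) by simp
    moreover have "\<mu> (left_translate G g c) = \<mu> c" if "c \<in> ?D" "0 \<le> c" for c
      using \<mu>(2)[OF left_translate_dominated[OF g that(1)] left_translate_nonneg[OF that(2)]]
        \<mu>(2)[OF that] m_inv[OF g that] by (simp only:)
    ultimately show ?thesis using ab by (metis add_right_cancel)
  qed
  moreover have "\<mu> f > 0"
  proof -
    have "adm f" using fD by (simp add: adm_def)
    from m_eq[OF this fD f(2)] P_pos[OF this] show ?thesis using \<mu>(2)[OF fD f(2)] by (simp add: R_def)
  qed
  ultimately show ?thesis
    using \<mu> m_nonneg unfolding invariant_integral_def by auto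
qed

section \<open>From invariant integrals to fixed points\<close>

lemma subspace_topological_dual: "subspace (topological_dual T)"
proof (rule subspaceI)
  show "0 \<in> topological_dual T"
    by (auto simp: topological_dual_def linear_map_on_def zero_fun_def)
next
  fix \<alpha> \<beta> assume "\<alpha> \<in> topological_dual T" "\<beta> \<in> topological_dual T"
  thus "\<alpha> + \<beta> \<in> topological_dual T"
    by (auto simp: topological_dual_def linear_map_on_def plus_fun_def algebra_simps
        intro!: continuous_map_add)
next
  fix c and \<alpha> :: "'a \<Rightarrow> real" assume "\<alpha> \<in> topological_dual T"
  thus "c *\<^sub>R \<alpha> \<in> topological_dual T"
    by (auto simp: topological_dual_def linear_map_on_def scaleR_fun_def algebra_simps
        intro!: continuous_map_real_mult)
qed

lemma topological_dual_compose:
  assumes "linear_map_on (topspace T) \<rho>" "continuous_map T T \<rho>" "\<psi> \<in> topological_dual T"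
  shows "(\<lambda>x. \<psi> (\<rho> x)) \<in> topological_dual T"
proof -
  have "continuous_map T euclideanreal (\<lambda>x. \<psi> (\<rho> x))"
    using continuous_map_compose[OF assms(2) topological_dual_continuous[OF assms(3)]]
    by (simp add: o_def)
  moreover have "\<And>x. x \<in> topspace T \<Longrightarrow> \<rho> x \<in> topspace T"
    using assms(2) continuous_map_image_subset_topspace by blast
  ultimately show ?thesis
    using assms(1) topological_dual_linear[OF assms(3)]
    unfolding topological_dual_def linear_map_on_def by auto
qed

lemma sum_fun_apply: "(\<Sum>i\<in>I. F i) y = (\<Sum>i\<in>I. (F i y :: real))"
  by (induction I rule: infinite_finite_induct) auto

text \<open>A functional \<open>\<psi>\<close> on the space gives the function \<open>g \<mapsto> \<psi> (g x)\<close> on the group, \<open>x\<close> being the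
  point with bounded orbit. Integrating these functions gives a positive invariant functional on the
  dual, which by Farkas' lemma and weak completeness is evaluation at a point of the cone.\<close>

lemma (in group) integrals_imp_fixed_point_property:
  assumes integrals: "\<And>f. f \<in> bounded_functions G \<Longrightarrow> 0 \<le> f \<Longrightarrow> f \<noteq> 0 \<Longrightarrow> \<exists>\<mu>. invariant_integral G f \<mu>"
  shows "fixed_point_property_for_cones G TYPE('e::real_vector)"
  unfolding fixed_point_property_for_cones_def
proof (intro allI impI, elim conjE)
  fix T :: "'e topology" and C \<pi>
  assume T: "hausdorff_locally_convex_space T" and cone: "proper_cone C" and "closedin T C"
    and complete: "complete_wrt (weak_uniformity T) C"
    and act: "continuous_linear_action G T \<pi>" and C_inv: "\<forall>g\<in>carrier G. \<pi> g ` C \<subseteq> C"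
    and "locally_bounded_action G T C \<pi>" "cobounded_action G T C \<pi>"
  let ?E = "topspace T" and ?T' = "topological_dual T"
  have E: "subspace ?E" using T unfolding hausdorff_locally_convex_space_def by simp
  have CE: "C \<subseteq> ?E" by (rule closedin_subset) fact
  have CD: "0 \<in> C" "\<And>x y. x \<in> C \<Longrightarrow> y \<in> C \<Longrightarrow> x + y \<in> C" "\<And>c x. c \<ge> 0 \<Longrightarrow> x \<in> C \<Longrightarrow> c *\<^sub>R x \<in> C"
    using cone unfolding proper_cone_def cone_def by auto
  interpret A: group_action G ?E \<pi> using act unfolding continuous_linear_action_def by simp
  have \<pi>_mult: "\<pi> (g \<otimes> h) x = \<pi> g (\<pi> h x)"
    if "g \<in> carrier G" "h \<in> carrier G" "x \<in> ?E" for g h x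
    using A.composition_rule that by blast
  have \<pi>_one: "\<pi> \<one> x = x" if "x \<in> ?E" for x
    using A.id_eq_one that by (metis restrict_apply')
  have \<pi>_C: "\<pi> g x \<in> C" if "g \<in> carrier G" "x \<in> C" for g x
    using C_inv that by auto
  have compose: "(\<lambda>x. \<psi> (\<pi> g x)) \<in> ?T'" if "g \<in> carrier G" "\<psi> \<in> ?T'" for g \<psi>
  proof (rule topological_dual_compose[OF _ _ that(2)])
    show "linear_map_on ?E (\<pi> g)" "continuous_map T T (\<pi> g)"
      using act that(1) unfolding continuous_linear_action_def by blast+
  qed
  obtain x where x: "x \<in> C" "x \<noteq> 0" "tvs_bounded T (orbit G \<pi> x)"
    using \<open>locally_bounded_action G T C \<pi>\<close> unfolding locally_bounded_action_def by blast
  have xE: "x \<in> ?E" using x(1) CE by blast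
  obtain \<phi> where \<phi>: "\<phi> \<in> ?T'" and \<phi>_cob: "\<And>\<psi>. \<psi> \<in> ?T' \<Longrightarrow> \<exists>gs. set gs \<subseteq> carrier G \<and>
        dual_le C \<psi> (\<Sum>g\<leftarrow>gs. dual_action G \<pi> g \<phi>) \<and> dual_le C (- \<psi>) (\<Sum>g\<leftarrow>gs. dual_action G \<pi> g \<phi>)"
    using \<open>cobounded_action G T C \<pi>\<close> unfolding cobounded_action_def by metis
  have cob: "\<exists>gs. set gs \<subseteq> carrier G \<and> (\<forall>c\<in>C. \<bar>\<psi> c\<bar> \<le> (\<Sum>g\<leftarrow>gs. \<phi> (\<pi> (inv g) c)))"
    if \<psi>: "\<psi> \<in> ?T'" for \<psi>
  proof -
    obtain gs where gs: "set gs \<subseteq> carrier G" "dual_le C \<psi> (\<Sum>g\<leftarrow>gs. dual_action G \<pi> g \<phi>)"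
      "dual_le C (- \<psi>) (\<Sum>g\<leftarrow>gs. dual_action G \<pi> g \<phi>)"
      using \<phi>_cob[OF \<psi>] by blast
    have "\<bar>\<psi> c\<bar> \<le> (\<Sum>g\<leftarrow>gs. \<phi> (\<pi> (inv g) c))" if "c \<in> C" for c
    proof (rule abs_leI)
      show "\<psi> c \<le> (\<Sum>g\<leftarrow>gs. \<phi> (\<pi> (inv g) c))"
        using bspec[OF gs(2)[unfolded dual_le_def] that]
        unfolding sum_list_fun_apply dual_action_def .
      show "- \<psi> c \<le> (\<Sum>g\<leftarrow>gs. \<phi> (\<pi> (inv g) c))"
        using bspec[OF gs(3)[unfolded dual_le_def] that]
        unfolding sum_list_fun_apply dual_action_def uminus_apply .
    qed
    with gs(1) show ?thesis by blast
  qed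
  \<comment> \<open>\<open>\<phi>\<close> need not be positive on \<open>C\<close>, so it is replaced by a sum of translates dominating \<open>\<bar>\<phi>\<bar>\<close>.\<close>
  obtain gs0 where gs0: "set gs0 \<subseteq> carrier G" "\<And>c. c \<in> C \<Longrightarrow> \<bar>\<phi> c\<bar> \<le> (\<Sum>g\<leftarrow>gs0. \<phi> (\<pi> (inv g) c))"
    using cob[OF \<phi>] by blast
  define \<theta> where "\<theta> = (\<Sum>g\<leftarrow>gs0. (\<lambda>c. \<phi> (\<pi> (inv g) c)))"
  have \<theta>_ge: "\<bar>\<phi> c\<bar> \<le> \<theta> c" if "c \<in> C" for c
    using gs0(2)[OF that] unfolding \<theta>_def sum_list_fun_apply .
  have \<theta>: "\<theta> \<in> ?T'"
    unfolding \<theta>_def using gs0(1)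
  proof (induction gs0)
    case Nil
    show ?case using subspace_0[OF subspace_topological_dual] by (simp only: list.map sum_list.Nil)
  next
    case (Cons g gs)
    thus ?case unfolding list.map sum_list.Cons
      by (intro subspace_add[OF subspace_topological_dual] compose \<phi>) auto
  qed
  define F where "F \<psi> = (\<lambda>g. if g \<in> carrier G then \<psi> (\<pi> g x) else 0)" for \<psi> :: "'e \<Rightarrow> real"
  define f where "f = F \<theta>"
  have F_bounded: "F \<psi> \<in> bounded_functions G" if \<psi>: "\<psi> \<in> ?T'" for \<psi>
  proof -
    obtain b where "\<And>y. y \<in> orbit G \<pi> x \<Longrightarrow> \<bar>\<psi> y\<bar> \<le> b"
      using tvs_bounded_dual[OF x(3) \<psi> E] by blast
    thus ?thesis
      by (intro bounded_functionsI[of _ _ b]) (auto simp: F_def orbit_def)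
  qed
  have F_dom: "F \<psi> \<in> dominated_functions G f" if \<psi>: "\<psi> \<in> ?T'" for \<psi>
  proof -
    obtain hs where hs: "set hs \<subseteq> carrier G" "\<And>c. c \<in> C \<Longrightarrow> \<bar>\<psi> c\<bar> \<le> (\<Sum>h\<leftarrow>hs. \<phi> (\<pi> (inv h) c))"
      using cob[OF \<psi>] by blast
    have "\<bar>F \<psi> g\<bar> \<le> translate_sum G f hs g" for g
    proof (cases "g \<in> carrier G")
      case True
      have gx: "\<pi> g x \<in> C" using \<pi>_C True x(1) .
      have "\<bar>F \<psi> g\<bar> \<le> (\<Sum>h\<leftarrow>hs. \<phi> (\<pi> (inv h) (\<pi> g x)))"
        using hs(2)[OF gx] True by (simp add: F_def)
      also have "\<dots> \<le> (\<Sum>h\<leftarrow>hs. left_translate G h f g)"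
      proof (rule sum_list_mono)
        fix h assume "h \<in> set hs"
        hence h: "h \<in> carrier G" using hs(1) by blast
        have "\<phi> (\<pi> (inv h) (\<pi> g x)) \<le> \<theta> (\<pi> (inv h) (\<pi> g x))"
          using \<theta>_ge[OF \<pi>_C[OF _ gx], of "inv h"] h by force
        also have "\<dots> = left_translate G h f g"
          using h True \<pi>_mult[of "inv h" g x] xE by (simp add: left_translate_def f_def F_def)
        finally show "\<phi> (\<pi> (inv h) (\<pi> g x)) \<le> left_translate G h f g" .
      qed
      finally show ?thesis by (simp add: translate_sum_def sum_list_fun_apply)
    next
      case False
      have "(\<Sum>h\<leftarrow>hs. left_translate G h f g) = 0"
        using False by (simp add: left_translate_def)
      thus ?thesis using False by (simp add: F_def translate_sum_def sum_list_fun_apply)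
    qed
    with hs(1) show ?thesis unfolding dominated_functions_def by blast
  qed
  have f0: "0 \<le> f"
    using \<theta>_ge \<pi>_C x(1) unfolding f_def F_def le_fun_def by (auto intro: order_trans[OF abs_ge_zero])
  \<comment> \<open>If \<open>f\<close> were \<open>0\<close>, then so would be every function it
    dominates. But a functional separating \<open>x\<close> from \<open>0\<close> gives such a
    function that is non-zero at \<open>\<one>\<close>.\<close>
  have "f \<noteq> 0"
  proof
    assume f: "f = 0"
    obtain \<psi> where \<psi>: "\<psi> \<in> ?T'" "\<psi> x \<noteq> 0" using topological_dual_separates[OF T xE x(2)] .
    have lt0: "left_translate G g f = 0" for g
      using f by (simp only: left_translate_linear)
    have "translate_sum G f gs = 0" for gs
      by (induction gs) (simp_all only: translate_sum_simps lt0 add_0_left)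
    hence "F \<psi> \<one> = 0" using F_dom[OF \<psi>(1)] unfolding dominated_functions_def by auto
    thus False using \<psi>(2) \<pi>_one[OF xE] by (simp add: F_def)
  qed
  then obtain \<mu> where "invariant_integral G f \<mu>"
    using integrals[of f] F_bounded[OF \<theta>] f0 unfolding f_def by blast
  hence \<mu>: "linear_map_on (dominated_functions G f) \<mu>"
      "\<And>h. h \<in> dominated_functions G f \<Longrightarrow> 0 \<le> h \<Longrightarrow> 0 \<le> \<mu> h"
      "\<And>g h. g \<in> carrier G \<Longrightarrow> h \<in> dominated_functions G f \<Longrightarrow> \<mu> (left_translate G g h) = \<mu> h"
      "\<mu> f > 0"
    unfolding invariant_integral_def by auto
  note D = subspace_dominated_functions[OF f0, of G]
  have approx: "\<exists>c\<in>C. \<forall>\<psi>\<in>I. \<bar>\<psi> c - \<mu> (F \<psi>)\<bar> < e"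
    if I: "finite I" "I \<subseteq> ?T'" and e: "e > 0" for I e
  proof -
    \<comment> \<open>Restricting to \<open>I\<close> by the value \<open>0\<close> makes
      \<open>ev\<close> additive on \<open>C\<close> as a map into functions; a
      \<open>\<psi>\<close> outside \<open>I\<close> may fail to be linear.\<close>
    define ev where "ev c = (\<lambda>\<psi>. if \<psi> \<in> I then \<psi> c else 0 :: real)" for c :: 'e
    have ev_add: "ev (c + d) = ev c + ev d" if "c \<in> C" "d \<in> C" for c d
    proof
      fix \<psi>
      have "\<psi> (c + d) = \<psi> c + \<psi> d" if "\<psi> \<in> I"
        using that I(2) \<open>c \<in> C\<close> \<open>d \<in> C\<close> CE
        by (intro linear_map_on_add[OF topological_dual_linear[of \<psi> T]]) blast+
      thus "ev (c + d) \<psi> = (ev c + ev d) \<psi>" by (simp add: ev_def)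
    qed
    have ev_scale: "ev (r *\<^sub>R c) = r *\<^sub>R ev c" if "c \<in> C" for r c
    proof
      fix \<psi>
      have "\<psi> (r *\<^sub>R c) = r *\<^sub>R \<psi> c" if "\<psi> \<in> I"
        using that I(2) \<open>c \<in> C\<close> CE
        by (intro linear_map_on_scale[OF topological_dual_linear[of \<psi> T]]) blast+
      thus "ev (r *\<^sub>R c) \<psi> = (r *\<^sub>R ev c) \<psi>" by (simp add: ev_def scaleR_fun_def)
    qed
    have "\<exists>k\<in>ev ` C. \<forall>\<psi>\<in>I. \<bar>k \<psi> - \<mu> (F \<psi>)\<bar> < e"
    proof (rule cone_approximates[OF I(1) _ _ _ _ e])
      have "ev 0 = 0" using ev_scale[OF CD(1), of 0] by simp
      thus "0 \<in> ev ` C" using imageI[OF CD(1), of ev] by (simp only:)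
      show "k + l \<in> ev ` C" if "k \<in> ev ` C" "l \<in> ev ` C" for k l
        using that CD(2) ev_add[symmetric] by (elim imageE) (simp only: imageI)
      show "r *\<^sub>R k \<in> ev ` C" if "r \<ge> 0" "k \<in> ev ` C" for r k
        using that CD(3) ev_scale[symmetric] by (elim imageE) (simp only: imageI)
      \<comment> \<open>A combination of functionals that is non-negative on \<open>C\<close> is so
        along the orbit of \<open>x\<close>, hence becomes a non-negative function on the group.
        Positivity of \<open>\<mu>\<close> gives the condition required by Farkas' lemma.\<close>
      fix a assume a: "\<And>k. k \<in> ev ` C \<Longrightarrow> 0 \<le> (\<Sum>\<psi>\<in>I. a \<psi> * k \<psi>)"
      have Fa: "(\<Sum>\<psi>\<in>I. a \<psi> *\<^sub>R F \<psi>) \<in> dominated_functions G f"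
        using I by (intro subspace_sum[OF D] subspace_scale[OF D] F_dom) auto
      have "0 \<le> (\<Sum>\<psi>\<in>I. a \<psi> *\<^sub>R F \<psi>)"
      proof (rule le_funI)
        fix g
        show "0 g \<le> (\<Sum>\<psi>\<in>I. a \<psi> *\<^sub>R F \<psi>) g"
        proof (cases "g \<in> carrier G")
          case True
          have "0 \<le> (\<Sum>\<psi>\<in>I. a \<psi> * ev (\<pi> g x) \<psi>)"
            by (rule a) (use \<pi>_C[OF True x(1)] in blast)
          also have "\<dots> = (\<Sum>\<psi>\<in>I. a \<psi> *\<^sub>R F \<psi>) g"
            unfolding sum_fun_apply using True
            by (intro sum.cong) (auto simp: ev_def F_def scaleR_fun_def)
          finally show ?thesis by simp
        next
          case False
          thus ?thesis unfolding sum_fun_apply by (simp add: F_def scaleR_fun_def)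
        qed
      qed
      hence "0 \<le> \<mu> (\<Sum>\<psi>\<in>I. a \<psi> *\<^sub>R F \<psi>)" using \<mu>(2) Fa by blast
      also have "\<dots> = (\<Sum>\<psi>\<in>I. a \<psi> *\<^sub>R \<mu> (F \<psi>))"
        by (rule linear_map_on_sum[OF \<mu>(1) D I(1)]) (use F_dom I in auto)
      finally show "0 \<le> (\<Sum>\<psi>\<in>I. a \<psi> * \<mu> (F \<psi>))" by simp
    qed
    then obtain c where "c \<in> C" "\<forall>\<psi>\<in>I. \<bar>ev c \<psi> - \<mu> (F \<psi>)\<bar> < e" by auto
    thus ?thesis by (intro bexI[of _ c]) (auto simp: ev_def)
  qed
  obtain z where z: "z \<in> C" and z_eq: "\<And>\<psi>. \<psi> \<in> ?T' \<Longrightarrow> \<psi> z = \<mu> (F \<psi>)"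
    using weakly_complete_approximable[OF CE complete approx] by blast
  have zE: "z \<in> ?E" using z CE by blast
  have "z \<noteq> 0"
    using z_eq[OF \<theta>] \<mu>(4) linear_map_on_zero[OF topological_dual_linear[OF \<theta>] E] by (auto simp: f_def)
  moreover have "\<pi> g z = z" if g: "g \<in> carrier G" for g
  proof (rule ccontr)
    assume "\<pi> g z \<noteq> z"
    have gz: "\<pi> g z \<in> ?E" using \<pi>_C[OF g z] CE by blast
    obtain \<psi> where \<psi>: "\<psi> \<in> ?T'" "\<psi> (\<pi> g z - z) \<noteq> 0"
      using topological_dual_separates[OF T subspace_diff[OF E gz zE]] \<open>\<pi> g z \<noteq> z\<close> by auto
    \<comment> \<open>Composition with \<open>\<pi> g\<close> corresponds to translation by
      \<open>inv g\<close> on the group, so invariance of \<open>\<mu>\<close> shows that no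
      functional distinguishes \<open>\<pi> g z\<close> from \<open>z\<close>.\<close>
    have "F (\<lambda>y. \<psi> (\<pi> g y)) = left_translate G (inv g) (F \<psi>)"
      using g \<pi>_mult xE by (auto simp: F_def left_translate_def fun_eq_iff)
    hence "\<psi> (\<pi> g z) = \<mu> (left_translate G (inv g) (F \<psi>))"
      using z_eq[OF compose[OF g \<psi>(1)]] by simp
    also have "\<dots> = \<psi> z" using \<mu>(3)[OF _ F_dom[OF \<psi>(1)]] g z_eq[OF \<psi>(1)] by simp
    finally have "\<psi> (\<pi> g z) = \<psi> z" .
    moreover have "\<psi> (\<pi> g z - z) = \<psi> (\<pi> g z) - \<psi> z"
      using linear_map_on_add[OF topological_dual_linear[OF \<psi>(1)] gz subspace_neg[OF E zE]]
        linear_map_on_minus[OF topological_dual_linear[OF \<psi>(1)] zE] by simp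
    ultimately show False using \<psi>(2) by simp
  qed
  ultimately show "\<exists>x\<in>C. x \<noteq> 0 \<and> (\<forall>g\<in>carrier G. \<pi> g x = x)" using z by blast
qed

section \<open>Spaces of functions with the topology of pointwise convergence\<close>

abbreviation pointwise_topology :: "('a \<Rightarrow> real) set \<Rightarrow> ('a \<Rightarrow> real) topology" where
  "pointwise_topology E \<equiv> subtopology euclidean E"

lemma open_fun_contains_box:
  fixes U :: "('a \<Rightarrow> real) set"
  assumes "open U" "u \<in> U"
  obtains J e where "finite J" "e > 0" "{w. \<forall>j\<in>J. \<bar>w j - u j\<bar> < e} \<subseteq> U"
proof -
  have "openin (product_topology (\<lambda>i. euclideanreal) UNIV) U"
    using assms(1) by (simp add: euclidean_product_topology)
  from product_topology_open_contains_basis[OF this assms(2)]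
  obtain X where X: "u \<in> (\<Pi>\<^sub>E i\<in>UNIV. X i)" "\<And>i. open (X i)" "finite {i. X i \<noteq> UNIV}"
    "(\<Pi>\<^sub>E i\<in>UNIV. X i) \<subseteq> U"
    by auto
  define J where "J = {i. X i \<noteq> UNIV}"
  have "\<forall>i. \<exists>e>0. ball (u i) e \<subseteq> X i"
    using X(1,2) openE by (metis PiE_E UNIV_I)
  then obtain e where e: "\<And>i. e i > 0" "\<And>i. ball (u i) (e i) \<subseteq> X i" by metis
  define d where "d = Min (insert 1 (e ` J))"
  have J: "finite J" using X(3) by (simp add: J_def)
  have d: "d > 0" "\<And>i. i \<in> J \<Longrightarrow> d \<le> e i" using e(1) J by (auto simp: d_def)
  have "{w. \<forall>j\<in>J. \<bar>w j - u j\<bar> < d} \<subseteq> (\<Pi>\<^sub>E i\<in>UNIV. X i)"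
  proof
    fix w assume w: "w \<in> {w. \<forall>j\<in>J. \<bar>w j - u j\<bar> < d}"
    have "w i \<in> X i" for i
    proof (cases "i \<in> J")
      case True
      hence "w i \<in> ball (u i) (e i)"
        using w d(2)[OF True] by (force simp: dist_real_def abs_minus_commute)
      thus ?thesis using e(2) by blast
    qed (simp add: J_def)
    thus "w \<in> (\<Pi>\<^sub>E i\<in>UNIV. X i)" unfolding PiE_UNIV_domain by simp
  qed
  with X(4) show thesis using J d(1) by (intro that[of J d]) auto
qed

lemma openin_pointwise_contains_box:
  assumes "openin (pointwise_topology E) U" "u \<in> U"
  obtains J e where "finite J" "e > 0" "{w \<in> E. \<forall>j\<in>J. \<bar>w j - u j\<bar> < e} \<subseteq> U"
proof -
  obtain V where V: "open V" "U = E \<inter> V" using assms(1) by (auto simp: openin_open)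
  have "u \<in> V" using assms(2) V by simp
  then obtain J e where "finite J" "e > 0" "{w. \<forall>j\<in>J. \<bar>w j - u j\<bar> < e} \<subseteq> V"
    by (rule open_fun_contains_box[OF V(1)])
  with V show thesis by (intro that[of J e]) auto
qed

lemma continuous_map_pointwise_eval:
  "continuous_map (pointwise_topology E) euclideanreal (\<lambda>u. u h)"
  by (rule continuous_map_from_subtopology) simp

lemma continuous_map_into_pointwise:
  assumes "\<And>x. x \<in> topspace X \<Longrightarrow> F x \<in> E" "\<And>h. continuous_map X euclideanreal (\<lambda>x. F x h)"
  shows "continuous_map X (pointwise_topology E) F"
proof -
  have "continuous_map X (product_topology (\<lambda>h. euclideanreal) UNIV) F"
    unfolding continuous_map_componentwise_UNIV using assms(2) by blast
  thus ?thesis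
    using assms(1) by (auto simp: euclidean_product_topology continuous_map_in_subtopology)
qed

lemma openin_pointwise_box:
  assumes "finite J"
  shows "openin (pointwise_topology E) {w \<in> E. \<forall>j\<in>J. \<bar>w j - u j\<bar> < e}"
  using assms
proof (induction J rule: finite_induct)
  case empty
  show ?case using openin_topspace[of "pointwise_topology E"] by simp
next
  case (insert j J)
  have "openin (pointwise_topology E) {w \<in> topspace (pointwise_topology E). w j \<in> {u j - e<..<u j + e}}"
    by (rule openin_continuous_map_preimage[OF continuous_map_pointwise_eval]) auto
  from openin_Int[OF this insert.IH]
  show ?case by (rule back_subst[of "openin _"]) (auto simp: abs_less_iff)
qed

lemma pointwise_topology_hausdorff_locally_convex:
  assumes E: "subspace E"
  shows "hausdorff_locally_convex_space (pointwise_topology E)"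
  unfolding hausdorff_locally_convex_space_def
proof (intro conjI)
  let ?T = "pointwise_topology E"
  show "subspace (topspace ?T)" using E by simp
  show "Hausdorff_space ?T" by (intro Hausdorff_space_subtopology)
      (simp add: euclidean_product_topology[symmetric] Hausdorff_space_product_topology)
  have ev1: "continuous_map (prod_topology X ?T) euclideanreal (\<lambda>p. snd p h)" for X :: "'b topology" and h
    using continuous_map_compose[OF continuous_map_snd continuous_map_pointwise_eval] by (simp add: o_def)
  have ev2: "continuous_map (prod_topology ?T X) euclideanreal (\<lambda>p. fst p h)" for X :: "'b topology" and h
    using continuous_map_compose[OF continuous_map_fst continuous_map_pointwise_eval] by (simp add: o_def)
  show "continuous_map (prod_topology ?T ?T) ?T (\<lambda>(x, y). x + y)"
  proof (rule continuous_map_into_pointwise)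
    show "(case p of (x, y) \<Rightarrow> x + y) \<in> E" if "p \<in> topspace (prod_topology ?T ?T)" for p
      using that subspace_add[OF E] by auto
    show "continuous_map (prod_topology ?T ?T) euclideanreal (\<lambda>p. (case p of (x, y) \<Rightarrow> x + y) h)" for h
      using continuous_map_add[OF ev2 ev1] by (simp add: case_prod_beta)
  qed
  show "continuous_map (prod_topology euclideanreal ?T) ?T (\<lambda>(c, x). c *\<^sub>R x)"
  proof (rule continuous_map_into_pointwise)
    show "(case p of (c, x) \<Rightarrow> c *\<^sub>R x) \<in> E" if "p \<in> topspace (prod_topology euclideanreal ?T)" for p
      using that subspace_scale[OF E] by auto
    show "continuous_map (prod_topology euclideanreal ?T) euclideanreal (\<lambda>p. (case p of (c, x) \<Rightarrow> c *\<^sub>R x) h)" for h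
      using continuous_map_real_mult[OF continuous_map_fst ev1]
      by (simp add: case_prod_beta scaleR_fun_def)
  qed
  show "neighbourhood_base_of convex ?T"
    unfolding neighbourhood_base_of
  proof (intro allI impI, elim conjE)
    fix W u assume W: "openin ?T W" "u \<in> W"
    obtain J e where J: "finite J" "e > 0" "{w \<in> E. \<forall>j\<in>J. \<bar>w j - u j\<bar> < e} \<subseteq> W"
      using openin_pointwise_contains_box[OF W] .
    let ?B = "{w \<in> E. \<forall>j\<in>J. \<bar>w j - u j\<bar> < e}"
    have "convex ?B"
    proof (rule convexI)
      fix v w and s t :: real assume vw: "v \<in> ?B" "w \<in> ?B" and st: "s \<ge> 0" "t \<ge> 0" "s + t = 1"
      have "\<bar>(s *\<^sub>R v + t *\<^sub>R w) j - u j\<bar> < e" if j: "j \<in> J" for j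
      proof -
        have "s *\<^sub>R v j + t *\<^sub>R w j \<in> ball (u j) e"
          by (rule convexD[OF convex_ball]) (use vw j st in \<open>auto simp: dist_real_def abs_minus_commute\<close>)
        thus ?thesis by (simp add: dist_real_def abs_minus_commute scaleR_fun_def)
      qed
      moreover have "s *\<^sub>R v + t *\<^sub>R w \<in> E"
        using vw by (intro subspace_add[OF E] subspace_scale[OF E]) auto
      ultimately show "s *\<^sub>R v + t *\<^sub>R w \<in> ?B" by blast
    qed
    moreover have "u \<in> ?B" using W J(2) openin_subset[OF W(1)] by auto
    ultimately show "\<exists>U V. openin ?T U \<and> convex V \<and> u \<in> U \<and> U \<subseteq> V \<and> V \<subseteq> W"
      using openin_pointwise_box[OF J(1), of E u e] J(3) by blast
  qed
qed

lemma eval_in_pointwise_dual: "(\<lambda>u. u h) \<in> topological_dual (pointwise_topology E)"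
  using continuous_map_pointwise_eval[of E h]
  unfolding topological_dual_def linear_map_on_def scaleR_fun_def by simp

text \<open>A neighbourhood of \<open>0\<close> contains a box restricting finitely many
  coordinates, and scaling \<open>u\<close> into the box gives the estimate. It reduces
  coboundedness to finitely many evaluations.\<close>

lemma pointwise_dual_bounded:
  assumes E: "subspace E" and \<psi>: "\<psi> \<in> topological_dual (pointwise_topology E)"
  obtains J M where "finite J" "M \<ge> 0" "\<And>u. u \<in> E \<Longrightarrow> \<bar>\<psi> u\<bar> \<le> M * (\<Sum>j\<in>J. \<bar>u j\<bar>)"
proof -
  let ?T = "pointwise_topology E"
  have lin: "linear_map_on E \<psi>" using topological_dual_linear[OF \<psi>] by simp
  have "openin ?T {u \<in> topspace ?T. \<psi> u \<in> {-1<..<1}}"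
    by (rule openin_continuous_map_preimage[OF topological_dual_continuous[OF \<psi>]]) auto
  moreover have "0 \<in> {u \<in> topspace ?T. \<psi> u \<in> {-1<..<1}}"
    using linear_map_on_zero[OF lin E] subspace_0[OF E] by simp
  ultimately obtain J e where J: "finite J" "e > 0"
    "{w \<in> E. \<forall>j\<in>J. \<bar>w j - 0 j\<bar> < e} \<subseteq> {u \<in> topspace ?T. \<psi> u \<in> {-1<..<1}}"
    by (rule openin_pointwise_contains_box)
  have "\<bar>\<psi> u\<bar> \<le> (1/e) * (\<Sum>j\<in>J. \<bar>u j\<bar>)" if u: "u \<in> E" for u
  \<comment> \<open>Working with each \<open>t\<close> strictly above the bound covers the case
    where all \<open>u j\<close> are \<open>0\<close>, in which division by the bound itself is
    impossible.\<close>
  proof (rule dense_ge)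
    fix t assume t: "(1/e) * (\<Sum>j\<in>J. \<bar>u j\<bar>) < t"
    have "0 \<le> (1/e) * (\<Sum>j\<in>J. \<bar>u j\<bar>)" using J(2) by (simp add: sum_nonneg)
    with t have t0: "t > 0" by linarith
    have "\<bar>((1/t) *\<^sub>R u) j - 0 j\<bar> < e" if "j \<in> J" for j
    proof -
      have "\<bar>u j\<bar> \<le> (\<Sum>j\<in>J. \<bar>u j\<bar>)" by (rule member_le_sum[OF that]) (use J in auto)
      also have "\<dots> < t * e" using t J(2) by (simp add: field_simps)
      finally show ?thesis using t0 by (simp add: scaleR_fun_def field_simps)
    qed
    hence "(1/t) *\<^sub>R u \<in> {u \<in> topspace ?T. \<psi> u \<in> {-1<..<1}}"
      using J(3) subspace_scale[OF E u] by blast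
    hence "\<bar>\<psi> ((1/t) *\<^sub>R u)\<bar> < 1" by auto
    thus "\<bar>\<psi> u\<bar> \<le> t"
      using linear_map_on_scale[OF lin u, of "1/t"] t0 by (simp add: abs_mult field_simps)
  qed
  with J show thesis by (intro that[of J "1/e"]) auto
qed

text \<open>The bounds may depend on the coordinate, because each neighbourhood of \<open>0\<close>
  contains a box that restricts only finitely many of them.\<close>

lemma pointwise_bounded:
  assumes S: "S \<subseteq> E" "\<And>h. \<exists>B. \<forall>u\<in>S. \<bar>u h\<bar> \<le> B" and E: "subspace E"
  shows "tvs_bounded (pointwise_topology E) S"
  unfolding tvs_bounded_def
proof (intro conjI allI impI, goal_cases)
  case 1
  show ?case using S(1) by simp
next
  case (2 U)
  then obtain J e where J: "finite J" "e > 0" "{w \<in> E. \<forall>j\<in>J. \<bar>w j - 0 j\<bar> < e} \<subseteq> U"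
    by (elim conjE) (rule openin_pointwise_contains_box)
  obtain B where B: "\<And>h u. u \<in> S \<Longrightarrow> \<bar>u h\<bar> \<le> B h" using S(2) by metis
  \<comment> \<open>The inserted \<open>1\<close> keeps \<open>s\<close> positive and the maximum
    defined when \<open>J\<close> is empty.\<close>
  define s where "s = Max (insert 1 (B ` J)) / e"
  have B_le: "B j \<le> s * e" if "j \<in> J" for j
    using J that by (auto simp: s_def intro: Max_ge)
  have s0: "s > 0"
    using J by (auto simp: s_def intro!: divide_pos_pos order_less_le_trans[OF zero_less_one Max_ge])
  have "S \<subseteq> (\<lambda>x. t *\<^sub>R x) ` U" if t: "t > s" for t
  proof
    fix u assume u: "u \<in> S"
    have "\<bar>((1/t) *\<^sub>R u) j - 0 j\<bar> < e" if "j \<in> J" for j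
    proof -
      have "\<bar>u j\<bar> \<le> s * e" using B[OF u, of j] B_le[OF that] by linarith
      also have "\<dots> < t * e" using t J(2) by simp
      finally show ?thesis using s0 t by (simp add: scaleR_fun_def field_simps)
    qed
    hence "(1/t) *\<^sub>R u \<in> U" using J(3) subspace_scale[OF E] u S(1) by blast
    hence "t *\<^sub>R ((1/t) *\<^sub>R u) \<in> (\<lambda>x. t *\<^sub>R x) ` U" by (rule imageI)
    thus "u \<in> (\<lambda>x. t *\<^sub>R x) ` U" using s0 t by simp
  qed
  with s0 show ?case by blast
qed

text \<open>Evaluations belong to the dual, so a weakly Cauchy filter is Cauchy in every coordinate
  and the real limits assemble to a function \<open>L\<close>. Closedness of \<open>C\<close> in the
  full product keeps \<open>L\<close> in \<open>C\<close> and hence in \<open>E\<close>, where every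
  element of the dual is continuous.\<close>

lemma closed_imp_pointwise_weakly_complete:
  assumes E: "subspace E" and C: "C \<subseteq> E" "closed C"
  shows "complete_wrt (weak_uniformity (pointwise_topology E)) C"
  unfolding complete_wrt_def
proof (intro allI impI, elim conjE)
  let ?T = "pointwise_topology E"
  fix F assume F: "F \<le> principal C" "F \<noteq> bot" "F \<times>\<^sub>F F \<le> weak_uniformity ?T"
  have evC: "eventually (\<lambda>u. u \<in> C) F" using F(1) by (simp add: le_principal)
  have "\<exists>l. ((\<lambda>u. u h) \<longlongrightarrow> l) F" for h
  proof -
    have "F \<times>\<^sub>F F \<le> filtercomap (map_prod (\<lambda>u. u h) (\<lambda>u. u h)) uniformity"
      using F(3) unfolding weak_uniformity_def
      by (rule order_trans) (intro le_infI2 INF_lower eval_in_pointwise_dual)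
    hence cau: "eventually P (filtercomap (map_prod (\<lambda>u. u h) (\<lambda>u. u h)) uniformity) \<Longrightarrow> eventually P (F \<times>\<^sub>F F)" for P
      unfolding le_filter_def by blast
    have "cauchy_filter (filtermap (\<lambda>u. u h) F)"
      unfolding cauchy_filter_metric_filtermap
    proof (intro allI impI)
      fix e :: real assume "e > 0"
      hence "eventually (\<lambda>z. dist (fst z) (snd z) < e) (uniformity :: (real \<times> real) filter)"
        unfolding eventually_uniformity_metric by auto
      from cau[OF eventually_filtercomapI[OF this]]
      show "\<exists>P. eventually P F \<and> (\<forall>x y. P x \<and> P y \<longrightarrow> dist (x h) (y h) < e)"
        unfolding eventually_prod_same by auto
    qed
    moreover have "complete (UNIV :: real set)" by (rule complete_UNIV)
    moreover have "filtermap (\<lambda>u. u h) F \<noteq> bot" using F(2) by (simp add: filtermap_bot_iff)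
    ultimately obtain l where "filtermap (\<lambda>u. u h) F \<le> nhds l"
      unfolding complete_uniform by (metis top_greatest principal_UNIV)
    thus ?thesis by (auto simp: filterlim_def)
  qed
  then obtain L where L: "\<And>h. ((\<lambda>u. u h) \<longlongrightarrow> L h) F" by metis
  have box: "eventually (\<lambda>u. \<forall>j\<in>J. \<bar>u j - L j\<bar> < e) F" if "finite J" "e > 0" for J e
    using tendstoD[OF L that(2)] that(1) by (intro eventually_ball_finite) (auto simp: dist_real_def)
  have LC: "L \<in> C"
  proof (rule ccontr)
    assume "L \<notin> C"
    hence "open (- C)" "L \<in> - C" using C(2) by auto
    then obtain J e where J: "finite J" "e > 0" "{w. \<forall>j\<in>J. \<bar>w j - L j\<bar> < e} \<subseteq> - C"
      by (rule open_fun_contains_box)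
    have "eventually (\<lambda>_. False) F"
      using box[OF J(1,2)] evC by eventually_elim (use J(3) in blast)
    thus False using F(2) by (simp add: trivial_limit_def)
  qed
  have "filterlim (\<lambda>y. (L, y)) (filtercomap (map_prod \<psi> \<psi>) uniformity) F"
    if \<psi>: "\<psi> \<in> topological_dual ?T" for \<psi>
    unfolding filterlim_filtercomap_iff
  proof (unfold filterlim_iff, intro allI impI)
    fix P assume "eventually P (uniformity :: (real \<times> real) filter)"
    then obtain e where e: "e > 0" "\<And>x y :: real. dist x y < e \<Longrightarrow> P (x, y)"
      unfolding eventually_uniformity_metric by auto
    have "openin ?T {u \<in> topspace ?T. \<psi> u \<in> ball (\<psi> L) e}"
      by (rule openin_continuous_map_preimage[OF topological_dual_continuous[OF \<psi>]]) auto
    moreover have "L \<in> {u \<in> topspace ?T. \<psi> u \<in> ball (\<psi> L) e}" using LC C(1) e(1) by auto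
    ultimately obtain J d where J: "finite J" "d > 0"
      "{w \<in> E. \<forall>j\<in>J. \<bar>w j - L j\<bar> < d} \<subseteq> {u \<in> topspace ?T. \<psi> u \<in> ball (\<psi> L) e}"
      by (rule openin_pointwise_contains_box)
    show "eventually (\<lambda>y. P ((map_prod \<psi> \<psi> \<circ> Pair L) y)) F"
      using box[OF J(1,2)] evC
    proof eventually_elim
      case (elim y)
      hence "y \<in> {u \<in> topspace ?T. \<psi> u \<in> ball (\<psi> L) e}" using J(3) C(1) by blast
      thus ?case using e(2) by (simp add: o_def)
    qed
  qed
  moreover have "filterlim (\<lambda>y. (L, y)) (principal (topspace ?T \<times> topspace ?T)) F"
    unfolding filterlim_principal using evC by eventually_elim (use LC C(1) in auto)
  ultimately have "filterlim (\<lambda>y. (L, y)) (weak_uniformity ?T) F"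
    unfolding weak_uniformity_def filterlim_inf filterlim_INF by blast
  with LC show "\<exists>x\<in>C. filterlim (\<lambda>y. (x, y)) (weak_uniformity ?T) F" by blast
qed

section \<open>From fixed points to invariant integrals\<close>

text \<open>The cone is that of positive functionals on the functions dominated by \<open>f\<close>, in the algebraic
  dual with the topology of pointwise convergence; a point evaluation has bounded orbit and
  evaluation at \<open>f\<close> is the cobounding functional. Functionals are extended by \<open>0\<close>.\<close>

lemma (in group) fixed_point_property_imp_integral:
  assumes fpp: "fixed_point_property_for_cones G TYPE(('a \<Rightarrow> real) \<Rightarrow> real)"
    and f: "f \<in> bounded_functions G" "0 \<le> f" "f \<noteq> 0"
  shows "\<exists>\<mu>. invariant_integral G f \<mu>"
proof -
  define D where "D = dominated_functions G f"
  have D: "subspace D" unfolding D_def by (rule subspace_dominated_functions[OF f(2)])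
  have fD: "f \<in> D" unfolding D_def by (rule self_dominated[OF f(2,1)])
  have DB: "h \<in> bounded_functions G" if "h \<in> D" for h
    using that dominated_functions_bounded[OF f(1)] unfolding D_def by blast
  have tD: "left_translate G g h \<in> D" if "g \<in> carrier G" "h \<in> D" for g h
    using that left_translate_dominated unfolding D_def by blast
  have sD: "translate_sum G f gs \<in> D" if "set gs \<subseteq> carrier G" for gs
    unfolding D_def by (rule translate_sum_dominated[OF f(2) that])
  have solid: "(\<lambda>x. \<bar>h x\<bar>) \<in> D" if "h \<in> D" for h
    using dominated_functions_solid[of h G f "\<lambda>x. \<bar>h x\<bar>"] that unfolding D_def by auto
  define E where "E = {u :: ('a \<Rightarrow> real) \<Rightarrow> real. linear_map_on D u \<and> (\<forall>h. h \<notin> D \<longrightarrow> u h = 0)}"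
  define C where "C = {u \<in> E. \<forall>h\<in>D. 0 \<le> h \<longrightarrow> 0 \<le> u h}"
  \<comment> \<open>The contragredient of translation. Elements of \<open>Bij E\<close> are
    extensional, whence the restriction to \<open>E\<close>.\<close>
  define \<pi> where "\<pi> g = (\<lambda>u\<in>E. \<lambda>h. if h \<in> D then u (left_translate G (inv g) h) else 0)" for g
  let ?T = "pointwise_topology E"
  have E: "subspace E"
    by (rule subspaceI)
      (auto simp: E_def linear_map_on_def algebra_simps scaleR_fun_def)
  have E_add: "u (h + k) = u h + u k" if "u \<in> E" "h \<in> D" "k \<in> D" for u h k
    using that linear_map_on_add unfolding E_def by blast
  have E_scale: "u (c *\<^sub>R h) = c * u h" if "u \<in> E" "h \<in> D" for u c h
    using that linear_map_on_scale[of D u h c] unfolding E_def by simp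
  have E_diff: "u (h - k) = u h - u k" if "u \<in> E" "h \<in> D" "k \<in> D" for u h k
    using E_add[OF that(1,2) subspace_neg[OF D that(3)]] E_scale[OF that(1,3), of "-1"] by simp
  have E_out: "u h = 0" if "u \<in> E" "h \<notin> D" for u h
    using that unfolding E_def by blast
  have E_zero: "u 0 = 0" if "u \<in> E" for u
    using E_scale[OF that fD, of 0] by simp
  have \<pi>_in: "\<pi> g u h = u (left_translate G (inv g) h)" if "u \<in> E" "h \<in> D" for g u h
    using that by (simp add: \<pi>_def)
  have \<pi>_out: "\<pi> g u h = 0" if "u \<in> E" "h \<notin> D" for g u h
    using that by (simp add: \<pi>_def)
  have \<pi>_E: "\<pi> g u \<in> E" if g: "g \<in> carrier G" and u: "u \<in> E" for g u
  proof -
    have "linear_map_on D (\<pi> g u)"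
      unfolding linear_map_on_def
    proof (intro conjI ballI allI)
      fix h k assume h: "h \<in> D" and k: "k \<in> D"
      show "\<pi> g u (h + k) = \<pi> g u h + \<pi> g u k"
        unfolding \<pi>_in[OF u subspace_add[OF D h k]] \<pi>_in[OF u h] \<pi>_in[OF u k] left_translate_linear
        using g h k by (intro E_add u tD) auto
    next
      fix c h assume h: "h \<in> D"
      show "\<pi> g u (c *\<^sub>R h) = c *\<^sub>R \<pi> g u h"
        unfolding \<pi>_in[OF u subspace_scale[OF D h]] \<pi>_in[OF u h] left_translate_linear real_scaleR_def
        using g h by (intro E_scale u tD) auto
    qed
    thus ?thesis using \<pi>_out[OF u] unfolding E_def by blast
  qed
  have \<pi>_mult: "\<pi> (g \<otimes> k) u = \<pi> g (\<pi> k u)" if g: "g \<in> carrier G" and k: "k \<in> carrier G" and u: "u \<in> E" for g k u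
  proof
    fix h show "\<pi> (g \<otimes> k) u h = \<pi> g (\<pi> k u) h"
    proof (cases "h \<in> D")
      case True
      have "\<pi> g (\<pi> k u) h = u (left_translate G (inv k) (left_translate G (inv g) h))"
        using \<pi>_in[OF \<pi>_E[OF k u] True] \<pi>_in[OF u tD[OF _ True]] g by simp
      thus ?thesis using \<pi>_in[OF u True] left_translate_mult g k by (simp add: inv_mult_group)
    qed (use \<pi>_out \<pi>_E u k in auto)
  qed
  have \<pi>_one: "\<pi> \<one> u = u" if u: "u \<in> E" for u
  proof
    fix h show "\<pi> \<one> u h = u h"
      using \<pi>_in[OF u, of h \<one>] \<pi>_out[OF u, of h \<one>] E_out[OF u, of h] left_translate_one[OF DB, of h]
      by (cases "h \<in> D") simp_all
  qed
  have \<pi>_inv: "\<pi> (inv g) (\<pi> g u) = u" "\<pi> g (\<pi> (inv g) u) = u" if "g \<in> carrier G" "u \<in> E" for g u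
    using \<pi>_mult[of "inv g" g u] \<pi>_mult[of g "inv g" u] \<pi>_one that by simp_all
  have \<pi>_Bij: "\<pi> g \<in> Bij E" if g: "g \<in> carrier G" for g
  proof -
    have "bij_betw (\<pi> g) E E"
      by (rule bij_betw_byWitness[of _ "\<pi> (inv g)"]) (use \<pi>_inv \<pi>_E g in auto)
    moreover have "\<pi> g \<in> extensional E" by (simp add: \<pi>_def)
    ultimately show ?thesis by (simp add: Bij_def)
  qed
  have "group_action G E \<pi>"
  proof (intro group_action.intro group_hom.intro group_hom_axioms.intro homI)
    show "group G" by (rule is_group)
    show "group (BijGroup E)" by (rule group_BijGroup)
    show "\<pi> g \<in> carrier (BijGroup E)" if "g \<in> carrier G" for g
      using \<pi>_Bij[OF that] by (simp add: BijGroup_def)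
    show "\<pi> (g \<otimes> k) = \<pi> g \<otimes>\<^bsub>BijGroup E\<^esub> \<pi> k" if "g \<in> carrier G" "k \<in> carrier G" for g k
    proof -
      have "\<pi> (g \<otimes> k) = compose E (\<pi> g) (\<pi> k)"
      proof
        fix u show "\<pi> (g \<otimes> k) u = compose E (\<pi> g) (\<pi> k) u"
          using \<pi>_mult[OF that, of u] by (cases "u \<in> E") (simp_all add: compose_def \<pi>_def)
      qed
      thus ?thesis using \<pi>_Bij that by (simp add: BijGroup_def)
    qed
  qed
  moreover have "linear_map_on E (\<pi> g)" if "g \<in> carrier G" for g
    unfolding linear_map_on_def
  proof (intro conjI ballI allI ext)
    fix u v h assume u: "u \<in> E" and v: "v \<in> E"
    show "\<pi> g (u + v) h = (\<pi> g u + \<pi> g v) h"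
      using u v subspace_add[OF E u v] by (simp add: \<pi>_def)
  next
    fix c u h assume u: "u \<in> E"
    show "\<pi> g (c *\<^sub>R u) h = (c *\<^sub>R \<pi> g u) h"
      using u subspace_scale[OF E u] by (simp add: \<pi>_def scaleR_fun_def)
  qed
  moreover have "continuous_map ?T ?T (\<pi> g)" if "g \<in> carrier G" for g
  proof (rule continuous_map_into_pointwise)
    show "\<pi> g u \<in> E" if "u \<in> topspace ?T" for u using \<pi>_E \<open>g \<in> carrier G\<close> that by simp
    fix h
    show "continuous_map ?T euclideanreal (\<lambda>u. \<pi> g u h)"
    proof (cases "h \<in> D")
      case True
      show ?thesis
        by (rule continuous_map_eq[OF continuous_map_pointwise_eval[of E "left_translate G (inv g) h"]])
          (use \<pi>_in True in simp)
    next
      case False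
      have "continuous_map ?T euclideanreal (\<lambda>u. 0)" by simp
      thus ?thesis by (rule continuous_map_eq) (use \<pi>_out False in simp)
    qed
  qed
  ultimately have action: "continuous_linear_action G ?T \<pi>"
    unfolding continuous_linear_action_def by simp
  have CE: "C \<subseteq> E" by (auto simp: C_def)
  have C_mono: "\<bar>u h\<bar> \<le> u k" if u: "u \<in> C" and h: "h \<in> D" and k: "k \<in> D" "\<And>x. \<bar>h x\<bar> \<le> k x" for u h k
  proof -
    have uE: "u \<in> E" using u CE by blast
    have "0 \<le> k - h" "0 \<le> k + h"
    proof -
      have "h x \<le> k x" "0 \<le> k x + h x" for x
        using k(2)[of x] by linarith+
      thus "0 \<le> k - h" "0 \<le> k + h"
        unfolding le_fun_def minus_apply plus_fun_apply zero_fun_apply by simp_all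
    qed
    hence "0 \<le> u (k - h)" "0 \<le> u (k + h)"
      using u subspace_diff[OF D k(1) h] subspace_add[OF D k(1) h] unfolding C_def by blast+
    thus ?thesis using E_diff[OF uE k(1) h] E_add[OF uE k(1) h] by simp
  qed
  \<comment> \<open>Membership is a family of equations and inequalities, each involving finitely
    many coordinates.\<close>
  have "closed C"
    unfolding C_def E_def linear_map_on_def Ball_def mem_Collect_eq real_scaleR_def
    by (intro closed_Collect_conj closed_Collect_all closed_Collect_imp open_Collect_const
        closed_Collect_eq closed_Collect_le continuous_on_add continuous_on_mult continuous_on_const
        continuous_on_product_coordinates)
  hence complete: "complete_wrt (weak_uniformity ?T) C" and closedC: "closedin ?T C"
    using closed_imp_pointwise_weakly_complete[OF E CE] closed_subset[OF CE] by auto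
  have C_ge: "0 \<le> u h" if "u \<in> C" "h \<in> D" "0 \<le> h" for u h
    using that unfolding C_def by blast
  have "proper_cone C"
    unfolding proper_cone_def cone_def
  proof (intro conjI ballI allI impI)
    fix u :: "('a \<Rightarrow> real) \<Rightarrow> real" and c :: real assume "u \<in> C" "c \<ge> 0"
    thus "c *\<^sub>R u \<in> C"
      using subspace_scale[OF E, of u c] unfolding C_def by (simp add: scaleR_fun_def)
  next
    fix u v assume "u \<in> C" "v \<in> C"
    thus "u + v \<in> C"
      using subspace_add[OF E, of u v] unfolding C_def by simp
  next
    have "0 \<in> C" using subspace_0[OF E] unfolding C_def by simp
    moreover have "u = 0" if "u \<in> C" "- u \<in> C" for u
    proof
      have uE: "u \<in> E" using that CE by blast
      have nn: "u h = 0" if "h \<in> D" "0 \<le> h" for h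
        using C_ge[OF \<open>u \<in> C\<close> that] C_ge[OF \<open>- u \<in> C\<close> that] by simp
      fix h show "u h = 0 h"
      proof (cases "h \<in> D")
        case True
        have "u (\<lambda>x. \<bar>h x\<bar>) = 0" by (rule nn[OF solid[OF True]]) (simp add: le_fun_def)
        hence "\<bar>u h\<bar> \<le> 0" using C_mono[OF \<open>u \<in> C\<close> True solid[OF True]] by simp
        thus ?thesis by simp
      qed (use E_out[OF uE] in simp)
    qed
    ultimately show "C \<inter> uminus ` C = {0}" by (auto simp: image_iff)
  qed
  have \<pi>_C: "\<pi> g u \<in> C" if g: "g \<in> carrier G" and u: "u \<in> C" for g u
  proof -
    have uE: "u \<in> E" using u CE by blast
    have "0 \<le> \<pi> g u h" if "h \<in> D" "0 \<le> h" for h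
      unfolding \<pi>_in[OF uE that(1)]
      using g that by (intro C_ge[OF u] tD left_translate_nonneg) auto
    thus ?thesis using \<pi>_E[OF g uE] unfolding C_def by blast
  qed
  have "locally_bounded_action G ?T C \<pi>"
  proof -
    obtain y where y: "f y \<noteq> 0" using f(3) by (auto simp: fun_eq_iff)
    hence yG: "y \<in> carrier G" using f(1) unfolding bounded_functions_iff by blast
    \<comment> \<open>The choice \<open>f y \<noteq> 0\<close> makes this evaluation non-zero. Its
      orbit consists of evaluations at other group elements, which are bounded at each
      \<open>h\<close> in \<open>D\<close> by the supremum of \<open>\<bar>h\<bar>\<close>.\<close>
    define u where "u = (\<lambda>h. if h \<in> D then h y else 0 :: real)"
    have uC: "u \<in> C"
      using subspace_add[OF D] subspace_scale[OF D]
      by (auto simp: C_def E_def u_def linear_map_on_def le_fun_def scaleR_fun_def)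
    have uE: "u \<in> E" using uC CE by blast
    have "u f \<noteq> 0" using y fD by (simp add: u_def)
    hence "u \<noteq> 0" by auto
    moreover have "tvs_bounded ?T (orbit G \<pi> u)"
    proof (rule pointwise_bounded[OF _ _ E])
      show "orbit G \<pi> u \<subseteq> E" using \<pi>_E uE by (auto simp: orbit_def)
      fix h
      show "\<exists>B. \<forall>w\<in>orbit G \<pi> u. \<bar>w h\<bar> \<le> B"
      proof (cases "h \<in> D")
        case True
        obtain B where B: "\<And>x. x \<in> carrier G \<Longrightarrow> \<bar>h x\<bar> \<le> B"
          using DB[OF True] unfolding bounded_functions_iff by blast
        have "\<bar>\<pi> g u h\<bar> \<le> B" if "g \<in> carrier G" for g
          using \<pi>_in[OF uE True] tD[OF _ True] that B yG by (simp add: u_def left_translate_def)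
        thus ?thesis by (auto simp: orbit_def)
      next
        case False
        thus ?thesis using \<pi>_out[OF uE] by (auto simp: orbit_def)
      qed
    qed
    ultimately show ?thesis using uC unfolding locally_bounded_action_def by blast
  qed
  have u_sum: "(\<Sum>g\<leftarrow>gs. dual_action G \<pi> g (\<lambda>u. u f)) u = u (translate_sum G f gs)"
    if "set gs \<subseteq> carrier G" "u \<in> E" for gs u
    using that(1)
  proof (induction gs)
    case Nil
    show ?case unfolding translate_sum_simps E_zero[OF that(2)] by simp
  next
    case (Cons g gs)
    hence g: "g \<in> carrier G" and gs: "set gs \<subseteq> carrier G" by auto
    have *: "u (left_translate G g f + translate_sum G f gs) = u (left_translate G g f) + u (translate_sum G f gs)"
      by (intro E_add that tD sD g gs fD)
    have "dual_action G \<pi> g (\<lambda>u. u f) u = u (left_translate G g f)"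
      using \<pi>_in[OF that(2) fD] g by (simp add: dual_action_def)
    thus ?case using Cons.IH[OF gs] unfolding translate_sum_simps * by simp
  qed
  have "cobounded_action G ?T C \<pi>"
    unfolding cobounded_action_def
  proof (intro bexI ballI)
    show "(\<lambda>u. u f) \<in> topological_dual ?T" by (rule eval_in_pointwise_dual)
    fix \<psi> assume "\<psi> \<in> topological_dual ?T"
    then obtain J M where J: "finite J" "M \<ge> 0" "\<And>u. u \<in> E \<Longrightarrow> \<bar>\<psi> u\<bar> \<le> M * (\<Sum>j\<in>J. \<bar>u j\<bar>)"
      by (rule pointwise_dual_bounded[OF E]) blast
    \<comment> \<open>For positive \<open>u\<close> one has
      \<open>\<bar>u j\<bar> \<le> u (\<lambda>x. \<bar>j x\<bar>)\<close>, so \<open>u k\<close>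
      majorises \<open>\<bar>\<psi> u\<bar>\<close>; the \<open>j\<close> outside \<open>D\<close>
      contribute \<open>0\<close>. As \<open>k\<close> lies in \<open>D\<close>, translates of
      \<open>f\<close> dominate it.\<close>
    define k where "k = (\<Sum>j\<in>J \<inter> D. M *\<^sub>R (\<lambda>x. \<bar>j x\<bar>))"
    have absD: "M *\<^sub>R (\<lambda>x. \<bar>j x\<bar>) \<in> D" if "j \<in> J \<inter> D" for j
      using that by (intro subspace_scale[OF D] solid) auto
    have kD: "k \<in> D"
      unfolding k_def by (rule subspace_sum[OF D absD])
    obtain gs where gs: "set gs \<subseteq> carrier G" "\<And>x. \<bar>k x\<bar> \<le> translate_sum G f gs x"
      using kD unfolding D_def dominated_functions_def by blast
    have le: "\<bar>\<psi> u\<bar> \<le> u (translate_sum G f gs)" if u: "u \<in> C" for u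
    proof -
      have uE: "u \<in> E" using u CE by blast
      have "\<bar>\<psi> u\<bar> \<le> M * (\<Sum>j\<in>J. \<bar>u j\<bar>)" by (rule J(3)[OF uE])
      also have "(\<Sum>j\<in>J. \<bar>u j\<bar>) = (\<Sum>j\<in>J \<inter> D. \<bar>u j\<bar>)"
        using J(1) E_out[OF uE] by (intro sum.mono_neutral_right) auto
      also have "M * \<dots> = (\<Sum>j\<in>J \<inter> D. M * \<bar>u j\<bar>)" by (rule sum_distrib_left)
      also have "\<dots> \<le> (\<Sum>j\<in>J \<inter> D. M * u (\<lambda>x. \<bar>j x\<bar>))"
        using J(2) by (intro sum_mono mult_left_mono C_mono[OF u _ solid]) auto
      also have "\<dots> = (\<Sum>j\<in>J \<inter> D. u (M *\<^sub>R (\<lambda>x. \<bar>j x\<bar>)))"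
        by (intro sum.cong refl E_scale[OF uE, symmetric] solid) auto
      also have "\<dots> = u k"
      proof -
        have "(\<Sum>j\<in>A. u (M *\<^sub>R (\<lambda>x. \<bar>j x\<bar>))) = u (\<Sum>j\<in>A. M *\<^sub>R (\<lambda>x. \<bar>j x\<bar>))"
          if "finite A" "A \<subseteq> J \<inter> D" for A
          using that
        proof (induction A rule: finite_induct)
          case empty
          show ?case unfolding sum.empty E_zero[OF uE] ..
        next
          case (insert j A)
          have *: "u (M *\<^sub>R (\<lambda>x. \<bar>j x\<bar>) + (\<Sum>j\<in>A. M *\<^sub>R (\<lambda>x. \<bar>j x\<bar>)))
              = u (M *\<^sub>R (\<lambda>x. \<bar>j x\<bar>)) + u (\<Sum>j\<in>A. M *\<^sub>R (\<lambda>x. \<bar>j x\<bar>))"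
            using insert.prems by (intro E_add[OF uE] absD subspace_sum[OF D]) auto
          thus ?case using insert unfolding sum.insert[OF insert.hyps(1,2)] * by simp
        qed
        from this[of "J \<inter> D"] J(1) show ?thesis unfolding k_def by simp
      qed
      also have "u k \<le> \<bar>u k\<bar>" by simp
      also have "\<dots> \<le> u (translate_sum G f gs)"
        by (rule C_mono[OF u kD sD[OF gs(1)] gs(2)])
      finally show ?thesis .
    qed
    have "dual_le C \<psi> (\<Sum>g\<leftarrow>gs. dual_action G \<pi> g (\<lambda>u. u f))"
      "dual_le C (- \<psi>) (\<Sum>g\<leftarrow>gs. dual_action G \<pi> g (\<lambda>u. u f))"
      unfolding dual_le_def
    proof (safe)
      fix u assume u: "u \<in> C"
      note * = le[OF u] u_sum[OF gs(1), of u] u CE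
      show "\<psi> u \<le> (\<Sum>g\<leftarrow>gs. dual_action G \<pi> g (\<lambda>u. u f)) u"
        using * by (metis abs_le_D1 subsetD)
      show "(- \<psi>) u \<le> (\<Sum>g\<leftarrow>gs. dual_action G \<pi> g (\<lambda>u. u f)) u"
        using * by (metis abs_le_D2 subsetD uminus_apply)
    qed
    with gs(1) show "\<exists>gs. set gs \<subseteq> carrier G \<and> dual_le C \<psi> (\<Sum>g\<leftarrow>gs. dual_action G \<pi> g (\<lambda>u. u f)) \<and>
        dual_le C (- \<psi>) (\<Sum>g\<leftarrow>gs. dual_action G \<pi> g (\<lambda>u. u f))" by blast
  qed
  then obtain u where u: "u \<in> C" "u \<noteq> 0" "\<And>g. g \<in> carrier G \<Longrightarrow> \<pi> g u = u"
    using fpp[unfolded fixed_point_property_for_cones_def, rule_format, of ?T C \<pi>]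
      pointwise_topology_hausdorff_locally_convex[OF E] \<open>proper_cone C\<close> closedC complete action \<pi>_C
      \<open>locally_bounded_action G ?T C \<pi>\<close>
    by blast
  have uE: "u \<in> E" using u(1) CE by blast
  have inv: "u (left_translate G g h) = u h" if "g \<in> carrier G" "h \<in> D" for g h
    using \<pi>_in[OF uE that(2), of "inv g"] u(3)[of "inv g"] that(1) by simp
  \<comment> \<open>An invariant positive functional that vanishes at \<open>f\<close> vanishes on
    sums of translates of \<open>f\<close>, hence on all functions they dominate, and would be
    \<open>0\<close>.\<close>
  have "u f \<noteq> 0"
  proof
    assume uf: "u f = 0"
    have "u (translate_sum G f gs) = 0" if "set gs \<subseteq> carrier G" for gs
      using that
    proof (induction gs)
      case Nil
      show ?case unfolding translate_sum_simps by (rule E_zero[OF uE])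
    next
      case (Cons g gs)
      hence *: "u (left_translate G g f + translate_sum G f gs) = u (left_translate G g f) + u (translate_sum G f gs)"
        by (intro E_add uE tD sD fD) auto
      with Cons inv[OF _ fD, of g] uf show ?case unfolding translate_sum_simps * by simp
    qed
    hence "u h = 0" for h
    proof (cases "h \<in> D")
      case True
      then obtain gs where gs: "set gs \<subseteq> carrier G" "\<And>x. \<bar>h x\<bar> \<le> translate_sum G f gs x"
        unfolding D_def dominated_functions_def by blast
      have "\<bar>u h\<bar> \<le> u (translate_sum G f gs)" by (rule C_mono[OF u(1) True sD[OF gs(1)] gs(2)])
      thus ?thesis using \<open>\<And>gs. set gs \<subseteq> carrier G \<Longrightarrow> u (translate_sum G f gs) = 0\<close>[OF gs(1)] by simp
    qed (rule E_out[OF uE])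
    thus False using u(2) by (auto simp: fun_eq_iff)
  qed
  hence "u f > 0" using C_ge[OF u(1) fD f(2)] by simp
  moreover have "linear_map_on D u" using uE unfolding E_def by blast
  ultimately show ?thesis
    using inv C_ge[OF u(1)] unfolding invariant_integral_def D_def by blast
qed

section \<open>From invariant integrals to conditional means\<close>

lemma compact_Pi_UNIV:
  assumes "\<And>i. compact (X i)"
  shows "compact (Pi UNIV X :: ('i \<Rightarrow> 'b::topological_space) set)"
proof -
  have "compactin (product_topology (\<lambda>i. euclidean) UNIV) (PiE UNIV X)"
    unfolding compactin_PiE using assms by simp
  thus ?thesis by (simp add: euclidean_product_topology PiE_UNIV_domain)
qed

text \<open>Only second arguments are confined to \<open>F\<close>; first arguments range over all
  bounded functions below them. In the product rule \<open>k\<close> is also a second argument, so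
  it is confined too. The bounds \<open>0\<close> and \<open>1\<close> are left out because they are
  imposed by the compact cube.\<close>

definition conditional_mean_on ::
    "('g, 'm) monoid_scheme \<Rightarrow> ('g \<Rightarrow> real) set \<Rightarrow> (('g \<Rightarrow> real) \<Rightarrow> ('g \<Rightarrow> real) \<Rightarrow> real) \<Rightarrow> bool" where
  "conditional_mean_on G F P \<longleftrightarrow>
     (\<forall>h\<in>F. \<forall>f k. f \<in> bounded_functions G \<and> k \<in> bounded_functions G \<and> 0 \<le> f \<and> 0 \<le> k \<and> f + k \<le> h \<longrightarrow>
        P (f + k) h = P f h + P k h) \<and>
     (\<forall>h\<in>F. \<forall>k\<in>F. \<forall>f. f \<in> bounded_functions G \<and> 0 \<le> f \<and> f \<le> k \<and> k \<le> h \<longrightarrow>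
        P f h = P f k * P k h) \<and>
     (\<forall>h\<in>F. P h h = 1) \<and>
     (\<forall>h\<in>F. \<forall>g f. g \<in> carrier G \<and> f \<in> bounded_functions G \<and> 0 \<le> f \<and> f \<le> h \<and>
        left_translate G g f \<le> h \<longrightarrow> P (left_translate G g f) h = P f h)"

lemma conditional_mean_on_mono:
  "conditional_mean_on G F P \<Longrightarrow> F' \<subseteq> F \<Longrightarrow> conditional_mean_on G F' P"
  unfolding conditional_mean_on_def by (meson subsetD)

text \<open>Every clause is an equation between finitely many values of \<open>P\<close>, hence
  closed for pointwise convergence.\<close>

lemma closed_conditional_mean_on: "closed {P. conditional_mean_on G F P}"
proof -
  have ev: "continuous_on UNIV (\<lambda>P :: ('a \<Rightarrow> real) \<Rightarrow> ('a \<Rightarrow> real) \<Rightarrow> real. P f h)" for f h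
    by (rule continuous_on_product_then_coordinatewise[OF continuous_on_product_coordinates])
  show ?thesis
    unfolding conditional_mean_on_def Ball_def
    by (intro closed_Collect_conj closed_Collect_all closed_Collect_imp open_Collect_const
        closed_Collect_eq continuous_on_add continuous_on_mult continuous_on_const ev)
qed

text \<open>Take the integral normalised at the sum of \<open>F\<close> for the elements of \<open>F\<close> on which it does not
  vanish, and recurse on the others.\<close>

lemma (in group) finite_conditional_mean:
  assumes integrals: "\<And>f. f \<in> bounded_functions G \<Longrightarrow> 0 \<le> f \<Longrightarrow> f \<noteq> 0 \<Longrightarrow> \<exists>\<mu>. invariant_integral G f \<mu>"
    and F: "finite F" "\<And>h. h \<in> F \<Longrightarrow> h \<in> bounded_functions G \<and> 0 \<le> h \<and> h \<noteq> 0"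
  shows "\<exists>P. (\<forall>f h. 0 \<le> P f h \<and> P f h \<le> 1) \<and> conditional_mean_on G F P"
  using F
proof (induction F rule: finite_psubset_induct)
  case (psubset F)
  let ?B = "bounded_functions G"
  have FB: "h \<in> ?B" "0 \<le> h" "h \<noteq> 0" if "h \<in> F" for h using psubset.prems[OF that] by blast+
  show ?case
  proof (cases "F = {}")
    case True
    thus ?thesis by (intro exI[of _ "\<lambda>_ _. 0"]) (simp add: conditional_mean_on_def)
  next
    case False
    define w where "w = sum (\<lambda>h. h) F"
    have w_ge: "h \<le> w" if "h \<in> F" for h
      unfolding w_def by (rule member_le_sum[OF that]) (use FB psubset.hyps in auto)
    have wB: "w \<in> ?B" unfolding w_def by (rule subspace_sum[OF subspace_bounded_functions]) (rule FB)
    have w0: "0 \<le> w" unfolding w_def by (rule sum_nonneg) (rule FB)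
    have "w \<noteq> 0"
    proof
      assume "w = 0"
      obtain h where h: "h \<in> F" using False by blast
      have "h \<le> 0" using w_ge[OF h] \<open>w = 0\<close> by simp
      thus False using FB[OF h] by (simp add: order_antisym)
    qed
    then obtain \<mu> where "invariant_integral G w \<mu>" using integrals wB w0 by blast
    define D where "D = dominated_functions G w"
    have \<mu>: "linear_map_on D \<mu>" "\<And>h. h \<in> D \<Longrightarrow> 0 \<le> h \<Longrightarrow> 0 \<le> \<mu> h"
      "\<And>g h. g \<in> carrier G \<Longrightarrow> h \<in> D \<Longrightarrow> \<mu> (left_translate G g h) = \<mu> h" "\<mu> w > 0"
      using \<open>invariant_integral G w \<mu>\<close> unfolding invariant_integral_def D_def by auto
    have D: "subspace D" unfolding D_def by (rule subspace_dominated_functions[OF w0])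
    have wD: "w \<in> D" unfolding D_def by (rule self_dominated[OF w0 wB])
    have solid: "f \<in> D" if "h \<in> D" "0 \<le> f" "f \<le> h" for f h
    proof -
      have "\<bar>f x\<bar> \<le> \<bar>h x\<bar>" for x
        using le_funD[OF that(2), of x] le_funD[OF that(3), of x] by simp
      thus ?thesis using that(1) unfolding D_def by (rule dominated_functions_solid[rotated])
    qed
    have FD: "h \<in> D" if "h \<in> F" for h
      using solid[OF wD FB(2)[OF that] w_ge[OF that]] .
    have mono: "\<mu> f \<le> \<mu> h" if "h \<in> D" "0 \<le> f" "f \<le> h" for f h
    proof -
      have fD: "f \<in> D" by (rule solid[OF that])
      have "0 \<le> \<mu> (h - f)" using \<mu>(2) subspace_diff[OF D that(1) fD] that(3) by simp
      moreover have "\<mu> (h - f) + \<mu> f = \<mu> h"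
        using linear_map_on_add[OF \<mu>(1) subspace_diff[OF D that(1) fD] fD] by simp
      ultimately show ?thesis by linarith
    qed
    define F' where "F' = {h \<in> F. \<mu> h = 0}"
    \<comment> \<open>The recursion terminates because \<open>\<mu> w\<close> is positive and is the
      sum of the \<open>\<mu> h\<close>, so some element of \<open>F\<close> is not null.\<close>
    have "F' \<noteq> F"
    proof
      assume "F' = F"
      have "\<mu> w = (\<Sum>h\<in>F. \<mu> h)"
        using linear_map_on_sum[OF \<mu>(1) D psubset.hyps, of "\<lambda>h. h" "\<lambda>_. 1"] FD by (simp add: w_def)
      also have "\<dots> = 0" using \<open>F' = F\<close> unfolding F'_def by (intro sum.neutral) blast
      finally show False using \<mu>(4) by simp
    qed
    hence F': "F' \<subset> F" unfolding F'_def by blast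
    have "\<exists>P. (\<forall>f h. 0 \<le> P f h \<and> P f h \<le> 1) \<and> conditional_mean_on G F' P"
      by (rule psubset.IH[OF F'], rule psubset.prems) (use F' in blast)
    then obtain P' where P': "\<And>f h. 0 \<le> P' f h \<and> P' f h \<le> 1" "conditional_mean_on G F' P'"
      by metis
    \<comment> \<open>The default \<open>0\<close> keeps all values in \<open>[0,1]\<close>,
      including those at pairs where the quotient has no meaning, so that \<open>P\<close> lies in
      the cube.\<close>
    define P where "P f h =
      (if h \<in> F - F' then if 0 \<le> f \<and> f \<le> h then \<mu> f / \<mu> h else 0 else P' f h)" for f h
    have pos: "\<mu> h > 0" if "h \<in> F - F'" for h
      using that \<mu>(2)[OF FD FB(2), of h] unfolding F'_def by auto
    have P_pos: "P f h = \<mu> f / \<mu> h" if "h \<in> F - F'" "0 \<le> f" "f \<le> h" for f h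
      using that by (simp add: P_def)
    have P_null: "P f h = P' f h" if "h \<in> F'" for f h
      using that by (simp add: P_def)
    have "0 \<le> P f h \<and> P f h \<le> 1" for f h
    proof (cases "h \<in> F - F' \<and> 0 \<le> f \<and> f \<le> h")
      case True
      hence h: "h \<in> F - F'" "h \<in> D" and f: "0 \<le> f" "f \<le> h" using FD by blast+
      have "0 \<le> \<mu> f" "\<mu> f \<le> \<mu> h" using \<mu>(2) solid[OF h(2) f] mono[OF h(2) f] f(1) by blast+
      thus ?thesis unfolding P_pos[OF h(1) f] using pos[OF h(1)] by simp
    qed (use P'(1) in \<open>auto simp: P_def\<close>)
    moreover have "conditional_mean_on G F P"
      unfolding conditional_mean_on_def
    proof (intro conjI ballI allI impI, goal_cases)
      case (1 h f k)
      hence le: "f \<le> h" "k \<le> h"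
        by (auto intro: order_trans[rotated])
      show ?case
      proof (cases "h \<in> F'")
        case True
        thus ?thesis using P'(2) 1 unfolding conditional_mean_on_def P_null[OF True] by blast
      next
        case False
        hence h: "h \<in> F - F'" using 1 by blast
        have "\<mu> (f + k) = \<mu> f + \<mu> k"
          using solid[OF FD] h le 1 by (intro linear_map_on_add[OF \<mu>(1)]) auto
        moreover have "0 \<le> f + k" using 1 by simp
        ultimately show ?thesis using P_pos[OF h] le 1 by (simp add: add_divide_distrib)
      qed
    next
      case (2 h k f)
      have hD: "h \<in> D" "k \<in> D" using FD 2 by auto
      have \<mu>_le: "0 \<le> \<mu> f" "\<mu> f \<le> \<mu> k" "0 \<le> \<mu> k" "\<mu> k \<le> \<mu> h"
        using 2 hD mono \<mu>(2) solid FB(2) by auto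
      show ?case
      proof (cases "h \<in> F'")
        case True
        \<comment> \<open>Null functions are closed downwards: all terms of the rule belong to the
          lower scale and are governed by \<open>P'\<close>.\<close>
        hence k: "k \<in> F'" using \<mu>_le 2 unfolding F'_def by auto
        show ?thesis using P'(2) 2 True k unfolding conditional_mean_on_def P_null[OF True] P_null[OF k] by blast
      next
        case False
        hence h: "h \<in> F - F'" using 2 by blast
        have Ph: "P f h = \<mu> f / \<mu> h" "P k h = \<mu> k / \<mu> h"
          using P_pos[OF h] 2 FB(2) order_trans by blast+
        show ?thesis
        proof (cases "k \<in> F'")
          case True
          \<comment> \<open>Here the scales meet. Both \<open>P k h\<close> and \<open>P f h\<close>
            are \<open>0\<close> since \<open>f \<le> k\<close>, so the rule holds whatever value
            \<open>P'\<close> assigns to the pair \<open>f\<close>, \<open>k\<close>.\<close>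
          hence "\<mu> k = 0" unfolding F'_def by blast
          thus ?thesis using Ph \<mu>_le by simp
        next
          case False
          hence k: "k \<in> F - F'" using 2 by blast
          show ?thesis using Ph P_pos[OF k, of f] pos[OF k] 2 by simp
        qed
      qed
    next
      case (3 h)
      show ?case
      proof (cases "h \<in> F'")
        case True
        thus ?thesis using P'(2) unfolding conditional_mean_on_def P_null[OF True] by blast
      next
        case False
        hence h: "h \<in> F - F'" using 3 by blast
        show ?thesis using P_pos[OF h FB(2)] pos[OF h] 3 by simp
      qed
    next
      case (4 h g f)
      show ?case
      proof (cases "h \<in> F'")
        case True
        thus ?thesis using P'(2) 4 unfolding conditional_mean_on_def P_null[OF True] by blast
      next
        case False
        hence h: "h \<in> F - F'" using 4 by blast
        have f: "g \<in> carrier G" "0 \<le> f" "f \<le> h" "left_translate G g f \<le> h" using 4 by blast+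
        have "\<mu> (left_translate G g f) = \<mu> f"
          by (rule \<mu>(3)[OF f(1) solid[OF FD[OF 4(1)] f(2,3)]])
        thus ?thesis
          unfolding P_pos[OF h f(2,3)] P_pos[OF h left_translate_nonneg[OF f(2)] f(4)] by (rule arg_cong)
      qed
    qed
    ultimately show ?thesis by blast
  qed
qed

text \<open>The desired mean is a point common to closed subsets of a cube, one for each finite set
  of second arguments. Finitely many of these subsets meet because a mean for the union of the
  finite sets lies in all of them; two-element sets then recover each axiom.\<close>

lemma (in group) integrals_imp_invariant_conditional_mean:
  assumes integrals: "\<And>f. f \<in> bounded_functions G \<Longrightarrow> 0 \<le> f \<Longrightarrow> f \<noteq> 0 \<Longrightarrow> \<exists>\<mu>. invariant_integral G f \<mu>"
  shows "\<exists>P. invariant_conditional_mean G P"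
proof -
  let ?B = "bounded_functions G"
  define N where "N = {h \<in> ?B. 0 \<le> h \<and> h \<noteq> 0}"
  define K :: "(('a \<Rightarrow> real) \<Rightarrow> ('a \<Rightarrow> real) \<Rightarrow> real) set" where
    "K = Pi UNIV (\<lambda>f. Pi UNIV (\<lambda>h. {0..1}))"
  have K: "P \<in> K \<longleftrightarrow> (\<forall>f h. 0 \<le> P f h \<and> P f h \<le> 1)" for P
    unfolding K_def Pi_iff by simp
  have "compact K" unfolding K_def by (intro compact_Pi_UNIV compact_Icc)
  have "K \<inter> (\<Inter>F\<in>{F. finite F \<and> F \<subseteq> N}. {P. conditional_mean_on G F P}) \<noteq> {}"
  proof (rule compact_imp_fip_image[OF \<open>compact K\<close> closed_conditional_mean_on])
    fix \<F> assume \<F>: "finite \<F>" "\<F> \<subseteq> {F. finite F \<and> F \<subseteq> N}"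
    have "finite (\<Union>\<F>)" "\<Union>\<F> \<subseteq> N" using \<F> by auto
    hence "\<exists>P. (\<forall>f h. 0 \<le> P f h \<and> P f h \<le> 1) \<and> conditional_mean_on G (\<Union>\<F>) P"
      by (intro finite_conditional_mean[OF integrals]) (auto simp only: N_def subset_iff)
    then obtain P where P: "P \<in> K" "conditional_mean_on G (\<Union>\<F>) P"
      unfolding K by metis
    have "conditional_mean_on G F P" if "F \<in> \<F>" for F
      by (rule conditional_mean_on_mono[OF P(2) Union_upper[OF that]])
    with P(1) show "K \<inter> (\<Inter>F\<in>\<F>. {P. conditional_mean_on G F P}) \<noteq> {}"
      by blast
  qed
  then obtain P where P: "P \<in> K" "\<And>F. finite F \<Longrightarrow> F \<subseteq> N \<Longrightarrow> conditional_mean_on G F P"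
    by blast
  have P2: "conditional_mean_on G {k, h} P" if "k \<in> N" "h \<in> N" for k h
    using that by (intro P(2)) auto
  have N_above: "h \<in> N" if "h \<in> ?B" "0 \<le> k" "k \<le> h" "h \<noteq> 0" for h k
    using that order_trans[of 0 k h] by (simp add: N_def)
  have "invariant_conditional_mean G P"
    unfolding invariant_conditional_mean_def conditional_mean_def conditional_pair_def
  proof (intro conjI allI impI, goal_cases)
    case (1 f h)
    show ?case using P(1) unfolding K by blast
  next
    case (2 f h)
    show ?case using P(1) unfolding K by blast
  next
    case (3 f k h)
    hence "0 \<le> f + k" by simp
    hence "h \<in> N" using N_above 3 by blast
    from P2[OF this this] show ?case using 3 unfolding conditional_mean_on_def by blast
  next
    case (4 f k h)
    hence k: "k \<in> N" using N_above by blast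
    \<comment> \<open>The product axiom assumes that the middle function is non-zero;
      \<open>h\<close> inherits this by lying above it.\<close>
    have "h \<noteq> 0" using 4 order_antisym[of k 0] order_trans[of 0 f k] by blast
    hence "h \<in> N" using N_above 4 order_trans[of f k h] by blast
    from P2[OF k this] show ?case using 4 unfolding conditional_mean_on_def by blast
  next
    case (5 f)
    hence "f \<in> N" by (simp add: N_def)
    from P2[OF this this] show ?case unfolding conditional_mean_on_def by blast
  next
    case (6 g f h)
    hence "h \<in> N" using N_above by blast
    from P2[OF this this] show ?case using 6 unfolding conditional_mean_on_def by blast
  qed
  thus ?thesis by blast
qed

lemma (in group) invariant_conditional_mean_imp_fixed_point_property:
  assumes "invariant_conditional_mean G P"
  shows "fixed_point_property_for_cones G TYPE('e::real_vector)"
  by (rule integrals_imp_fixed_point_property) (rule invariant_conditional_mean_imp_integral[OF assms])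

text \<open>The fixed-point property is indexed by a type, over which no quantifier can range. The
  equivalence is therefore stated at a type large enough to produce the integrals, and the second
  conjunct, with \<open>'e\<close> free, gives the property over every type of vectors.\<close>

theorem theorem5:
  fixes G :: "('g, 'm) monoid_scheme"
  assumes "group G"
  shows "((\<exists>P. invariant_conditional_mean G P) \<longleftrightarrow>
            fixed_point_property_for_cones G TYPE(('g \<Rightarrow> real) \<Rightarrow> real)) \<and>
         ((\<exists>P. invariant_conditional_mean G P) \<longrightarrow>
            fixed_point_property_for_cones G TYPE('e::real_vector))"
proof -
  interpret group G by (rule assms)
  show ?thesis
  proof (intro conjI iffI impI)
    show "\<exists>P. invariant_conditional_mean G P"
      if "fixed_point_property_for_cones G TYPE(('g \<Rightarrow> real) \<Rightarrow> real)"
      by (rule integrals_imp_invariant_conditional_mean) (rule fixed_point_property_imp_integral[OF that])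
  qed (elim exE, rule invariant_conditional_mean_imp_fixed_point_property, assumption)+
qed

end
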